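(* Let $\theta\in[0,1]$ be irrational and let $r=U^m$ ($m$ an integer). Then the spectral triples $(\mathcal A_\theta^\infty,\mathcal H,D_0)$ and $(\mathcal A_\theta^\infty,\mathcal H,D)$ defined in the context are not unitarily equivalent.
   Context: $\mathcal A_\theta$ is the $C^*$-algebra generated by unitaries $U,V$ with $UV=e^{2\pi i\theta}VU$; $\mathcal A_\theta^\infty=\{\sum_{p,q\in\mathbb Z}a_{pq}U^pV^q:\ \sup_{p,q}|p^kq^la_{pq}|<\infty\ \forall k,l\in\mathbb N\}$; $\tau(\sum a_{pq}U^pV^q)=a_{00}$, $L^2(\tau)=L^2(\mathcal A_\theta,\tau)$ and $\mathcal H=L^2(\tau)\oplus L^2(\tau)$, on which $\mathcal A_\theta^\infty$ acts by diagonal left multiplication. On $L^2(\tau)$ let $d_1,d_2$ be the selfadjoint operators with $d_1(U^pV^q)=pU^pV^q$, $d_2(U^pV^q)=qU^pV^q$, and let $d_r(x)=rx-xr$. Define $$D_0=\begin{pmatrix}0&d_1+id_2\\ d_1-id_2&0\end{pmatrix},\qquad D=D_0+\begin{pmatrix}0&d_r\\ d_{r^*}&0\end{pmatrix},$$ both essentially selfadjoint on $\mathcal A_\theta^\infty\oplus\mathcal A_\theta^\infty$ (closures denoted by the same symbols). Two spectral triples $(\mathcal A_1,\mathcal H_1,D_1)$ and $(\mathcal A_2,\mathcal H_2,D_2)$, with representations $\pi_j$ of $\mathcal A_j$ on $\mathcal H_j$, are unitarily equivalent if there is a unitary $W:\mathcal H_1\to\mathcal H_2$ such that $D_2=WD_1W^*$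 and $\pi_2(\cdot)=W\pi_1(\cdot)W^*$.
   Formalization: The integer m is assumed to be nonzero: for m = 0 one has r = 1, so d_r = 0 and D = D_0, and the two spectral triples coincide, making the claim false in that case. *)

theory Defs
  imports "HOL-Analysis.Analysis"
begin

section \<open>Complex Hilbert spaces and unital C*-algebras\<close>

class scaleC =
  fixes scaleC :: "complex \<Rightarrow> 'a \<Rightarrow> 'a"  (infixr "*\<^sub>C" 75)

class complex_vector = real_vector + scaleC +
  assumes scaleC_add_right: "c *\<^sub>C (x + y) = c *\<^sub>C x + c *\<^sub>C y"
    and scaleC_add_left: "(c + d) *\<^sub>C x = c *\<^sub>C x + d *\<^sub>C x"
    and scaleC_scaleC: "c *\<^sub>C (d *\<^sub>C x) = (c * d) *\<^sub>C x"
    and scaleC_of_real: "complex_of_real t *\<^sub>C x = t *\<^sub>R x"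

instantiation complex :: complex_vector
begin
definition "c *\<^sub>C (z::complex) = c * z"
instance
  by standard (auto simp: scaleC_complex_def algebra_simps scaleR_conv_of_real)
end

instantiation prod :: (complex_vector, complex_vector) complex_vector
begin
definition "c *\<^sub>C x = (c *\<^sub>C fst x, c *\<^sub>C snd x)"
instance
  by standard
    (auto simp: scaleC_prod_def scaleC_add_right scaleC_add_left scaleC_scaleC scaleC_of_real
      prod_eq_iff)
end

definition clinear :: "('a::complex_vector \<Rightarrow> 'b::complex_vector) \<Rightarrow> bool" where
  "clinear f \<longleftrightarrow> (\<forall>x y. f (x + y) = f x + f y) \<and> (\<forall>c x. f (c *\<^sub>C x) = c *\<^sub>C f x)"

text \<open>The complex inner product is conjugate linear in its first argument.  Its real part is the
  inner product of the underlying real Hilbert space, which fixes norm and topology.\<close>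

class complex_hilbert_space = complex_vector + real_inner + complete_space +
  fixes cinner :: "'a \<Rightarrow> 'a \<Rightarrow> complex"
  assumes cinner_add_right: "cinner x (y + z) = cinner x y + cinner x z"
    and cinner_scaleC_right: "cinner x (c *\<^sub>C y) = c * cinner x y"
    and cinner_commute: "cinner x y = cnj (cinner y x)"
    and Re_cinner: "Re (cinner x y) = inner x y"

instantiation prod :: (complex_hilbert_space, complex_hilbert_space) complex_hilbert_space
begin
definition "cinner x y = cinner (fst x) (fst y) + cinner (snd x) (snd y)"
instance
proof
  fix x y z :: "'a \<times> 'b" and c :: complex
  show "cinner x (y + z) = cinner x y + cinner x z"
    by (simp add: cinner_prod_def cinner_add_right)
  show "cinner x (c *\<^sub>C y) = c * cinner x y"
    by (simp add: cinner_prod_def scaleC_prod_def cinner_scaleC_right algebra_simps)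
  show "cinner x y = cnj (cinner y x)"
    by (simp add: cinner_prod_def flip: cinner_commute)
  show "Re (cinner x y) = inner x y"
    by (simp add: cinner_prod_def inner_prod_def Re_cinner)
qed
end

definition unitary_op :: "('a::complex_hilbert_space \<Rightarrow> 'b::complex_hilbert_space) \<Rightarrow> bool" where
  "unitary_op W \<longleftrightarrow> clinear W \<and> surj W \<and> (\<forall>x y. cinner (W x) (W y) = cinner x y)"

class cstar_algebra = complex_vector + real_normed_algebra_1 + complete_space +
  fixes adj :: "'a \<Rightarrow> 'a"
  assumes norm_scaleC: "norm (c *\<^sub>C x) = cmod c * norm x"
    and mult_scaleC_left: "(c *\<^sub>C x) * y = c *\<^sub>C (x * y)"
    and mult_scaleC_right: "x * (c *\<^sub>C y) = c *\<^sub>C (x * y)"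
    and adj_add: "adj (x + y) = adj x + adj y"
    and adj_scaleC: "adj (c *\<^sub>C x) = cnj c *\<^sub>C adj x"
    and adj_mult: "adj (x * y) = adj y * adj x"
    and adj_adj: "adj (adj x) = x"
    and cstar_identity: "norm (adj x * x) = (norm x)\<^sup>2"

definition unitary_elem :: "'a::cstar_algebra \<Rightarrow> bool" where
  "unitary_elem u \<longleftrightarrow> adj u * u = 1 \<and> u * adj u = 1"

definition star_subalgebra :: "'a::cstar_algebra set \<Rightarrow> bool" where
  "star_subalgebra B \<longleftrightarrow> 1 \<in> B \<and> (\<forall>x\<in>B. \<forall>y\<in>B. x + y \<in> B \<and> x * y \<in> B) \<and>
     (\<forall>x\<in>B. adj x \<in> B \<and> (\<forall>c. c *\<^sub>C x \<in> B))"

definition cstar_generated :: "'a::cstar_algebra set \<Rightarrow> 'a set" where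
  "cstar_generated S = \<Inter>{B. S \<subseteq> B \<and> closed B \<and> star_subalgebra B}"

text \<open>Integer powers of a unitary element: negative powers are powers of the adjoint.\<close>

definition upow :: "'a::cstar_algebra \<Rightarrow> int \<Rightarrow> 'a" where
  "upow u n = (if n \<ge> 0 then u ^ nat n else adj u ^ nat (- n))"


section \<open>Unbounded operators\<close>

text \<open>An unbounded operator is represented by its graph; its domain is the relational domain, and
  the closure of an operator is the topological closure of its graph.\<close>

type_synonym ('a, 'b) graph = "('a \<times> 'b) set"

definition op_adjoint :: "('h::complex_hilbert_space, 'h) graph \<Rightarrow> ('h, 'h) graph" where
  "op_adjoint T = {(y, z). \<forall>(x, w)\<in>T. cinner y w = cinner z x}"

definition op_selfadjoint :: "('h::complex_hilbert_space, 'h) graph \<Rightarrow> bool" where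
  "op_selfadjoint T \<longleftrightarrow> closure (Domain T) = UNIV \<and> op_adjoint T = T"

definition op_add :: "('a, 'b::complex_vector) graph \<Rightarrow> ('a, 'b) graph \<Rightarrow> ('a, 'b) graph" where
  "op_add S T = {(x, u + v) | x u v. (x, u) \<in> S \<and> (x, v) \<in> T}"

definition op_scaleC :: "complex \<Rightarrow> ('a, 'b::complex_vector) graph \<Rightarrow> ('a, 'b) graph" where
  "op_scaleC c T = {(x, c *\<^sub>C u) | x u. (x, u) \<in> T}"

definition op_restrict :: "('a, 'b) graph \<Rightarrow> 'a set \<Rightarrow> ('a, 'b) graph" where
  "op_restrict T X = {(x, u). (x, u) \<in> T \<and> x \<in> X}"

text \<open>The operator matrix with zero diagonal, upper right entry \<open>S\<close> and lower left entry \<open>T\<close>.\<close>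

definition op_offdiag :: "('h, 'h) graph \<Rightarrow> ('h, 'h) graph \<Rightarrow> ('h \<times> 'h, 'h \<times> 'h) graph" where
  "op_offdiag S T = {((x, y), (u, v)) | x y u v. (y, u) \<in> S \<and> (x, v) \<in> T}"


section \<open>Unitary equivalence of spectral triples\<close>

record ('a, 'h) triple =
  algebra :: "'a set"
  repr :: "'a \<Rightarrow> 'h \<Rightarrow> 'h"
  dirac :: "('h, 'h) graph"

text \<open>The condition \<open>\<pi>\<^sub>2 = W \<pi>\<^sub>1 W*\<close> presupposes a common algebra.  For a unitary \<open>W\<close> the adjoint is
  \<open>inv W\<close>, and the graph of \<open>W D\<^sub>1 W*\<close> is the image of the graph of \<open>D\<^sub>1\<close> under \<open>W\<close> on both sides.\<close>

definition unitarily_equivalent ::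
    "('a, 'h1::complex_hilbert_space) triple \<Rightarrow> ('a, 'h2::complex_hilbert_space) triple \<Rightarrow> bool" where
  "unitarily_equivalent S T \<longleftrightarrow> algebra S = algebra T \<and>
     (\<exists>W. unitary_op W \<and>
        dirac T = {(W x, W y) | x y. (x, y) \<in> dirac S} \<and>
        (\<forall>a\<in>algebra S. repr T a = W \<circ> repr S a \<circ> inv W))"


section \<open>The noncommutative torus\<close>

text \<open>The whole type is the C*-algebra generated by the unitaries \<open>U\<close> and \<open>V\<close>.  For irrational
  \<open>\<theta>\<close> these relations determine the C*-algebra up to isomorphism, so no universality clause is
  needed.\<close>

definition nc_torus :: "real \<Rightarrow> 'a::cstar_algebra \<Rightarrow> 'a \<Rightarrow> bool" where
  "nc_torus \<theta> U V \<longleftrightarrow> unitary_elem U \<and> unitary_elem V \<and>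
     U * V = exp (2 * of_real pi * \<i> * of_real \<theta>) *\<^sub>C (V * U) \<and>
     cstar_generated {U, V} = UNIV"

definition rapidly_decreasing :: "(int \<times> int \<Rightarrow> complex) \<Rightarrow> bool" where
  "rapidly_decreasing a \<longleftrightarrow>
     (\<forall>k l :: nat. bdd_above (range (\<lambda>(p, q). cmod (of_int p ^ k * of_int q ^ l * a (p, q)))))"

definition nct_series :: "'a::cstar_algebra \<Rightarrow> 'a \<Rightarrow> (int \<times> int \<Rightarrow> complex) \<Rightarrow> 'a" where
  "nct_series U V a = (\<Sum>\<^sub>\<infinity>(p, q)\<in>UNIV. a (p, q) *\<^sub>C (upow U p * upow V q))"

definition nct_smooth :: "'a::cstar_algebra \<Rightarrow> 'a \<Rightarrow> 'a set" where
  "nct_smooth U V = {nct_series U V a | a. rapidly_decreasing a}"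

definition nct_trace :: "'a::cstar_algebra \<Rightarrow> 'a \<Rightarrow> ('a \<Rightarrow> complex) \<Rightarrow> bool" where
  "nct_trace U V \<tau> \<longleftrightarrow> clinear \<tau> \<and> bounded_linear \<tau> \<and>
     (\<forall>a. rapidly_decreasing a \<longrightarrow> \<tau> (nct_series U V a) = a (0, 0))"

text \<open>The Hilbert space \<open>'h\<close>, with the map \<open>\<Lambda>\<close> that sends an element of the algebra to its class, is
  \<open>L\<^sup>2(\<tau>)\<close>: the completion of the algebra in the inner product \<open>(a, b) \<mapsto> \<tau> (a* b)\<close>.\<close>

definition L2_space :: "('a::cstar_algebra \<Rightarrow> complex) \<Rightarrow> ('a \<Rightarrow> 'h::complex_hilbert_space) \<Rightarrow> bool" where
  "L2_space \<tau> \<Lambda> \<longleftrightarrow> clinear \<Lambda> \<and> (\<forall>a b. cinner (\<Lambda> a) (\<Lambda> b) = \<tau> (adj a * b)) \<and>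
     closure (range \<Lambda>) = UNIV"

definition left_mult :: "('a::cstar_algebra \<Rightarrow> 'h::complex_hilbert_space) \<Rightarrow> 'a \<Rightarrow> 'h \<Rightarrow> 'h" where
  "left_mult \<Lambda> a = (THE T. clinear T \<and> bounded_linear T \<and> (\<forall>b. T (\<Lambda> b) = \<Lambda> (a * b)))"

text \<open>The selfadjoint operators \<open>d\<^sub>1\<close> and \<open>d\<^sub>2\<close> are determined by their values on the orthonormal
  basis of the monomials \<open>U\<^sup>p V\<^sup>q\<close>.\<close>

definition nct_d1 ::
    "'a::cstar_algebra \<Rightarrow> 'a \<Rightarrow> ('a \<Rightarrow> 'h::complex_hilbert_space) \<Rightarrow> ('h, 'h) graph" where
  "nct_d1 U V \<Lambda> = (THE T. op_selfadjoint T \<and>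
     (\<forall>p q. (\<Lambda> (upow U p * upow V q), of_int p *\<^sub>C \<Lambda> (upow U p * upow V q)) \<in> T))"

definition nct_d2 ::
    "'a::cstar_algebra \<Rightarrow> 'a \<Rightarrow> ('a \<Rightarrow> 'h::complex_hilbert_space) \<Rightarrow> ('h, 'h) graph" where
  "nct_d2 U V \<Lambda> = (THE T. op_selfadjoint T \<and>
     (\<forall>p q. (\<Lambda> (upow U p * upow V q), of_int q *\<^sub>C \<Lambda> (upow U p * upow V q)) \<in> T))"

definition nct_commutator ::
    "'a::cstar_algebra \<Rightarrow> 'a \<Rightarrow> ('a \<Rightarrow> 'h::complex_hilbert_space) \<Rightarrow> 'a \<Rightarrow> ('h, 'h) graph" where
  "nct_commutator U V \<Lambda> r = {(\<Lambda> x, \<Lambda> (r * x - x * r)) | x. x \<in> nct_smooth U V}"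

definition nct_dirac0_matrix ::
    "'a::cstar_algebra \<Rightarrow> 'a \<Rightarrow> ('a \<Rightarrow> 'h::complex_hilbert_space) \<Rightarrow> ('h \<times> 'h, 'h \<times> 'h) graph" where
  "nct_dirac0_matrix U V \<Lambda> =
     op_offdiag (op_add (nct_d1 U V \<Lambda>) (op_scaleC \<i> (nct_d2 U V \<Lambda>)))
                (op_add (nct_d1 U V \<Lambda>) (op_scaleC (- \<i>) (nct_d2 U V \<Lambda>)))"

definition nct_core ::
    "'a::cstar_algebra \<Rightarrow> 'a \<Rightarrow> ('a \<Rightarrow> 'h::complex_hilbert_space) \<Rightarrow> ('h \<times> 'h) set" where
  "nct_core U V \<Lambda> = (\<Lambda> ` nct_smooth U V) \<times> (\<Lambda> ` nct_smooth U V)"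

definition nct_dirac0 ::
    "'a::cstar_algebra \<Rightarrow> 'a \<Rightarrow> ('a \<Rightarrow> 'h::complex_hilbert_space) \<Rightarrow> ('h \<times> 'h, 'h \<times> 'h) graph" where
  "nct_dirac0 U V \<Lambda> = closure (op_restrict (nct_dirac0_matrix U V \<Lambda>) (nct_core U V \<Lambda>))"

definition nct_dirac ::
    "'a::cstar_algebra \<Rightarrow> 'a \<Rightarrow> ('a \<Rightarrow> 'h::complex_hilbert_space) \<Rightarrow> 'a \<Rightarrow> ('h \<times> 'h, 'h \<times> 'h) graph" where
  "nct_dirac U V \<Lambda> r = closure (op_restrict
     (op_add (nct_dirac0_matrix U V \<Lambda>)
        (op_offdiag (nct_commutator U V \<Lambda> r) (nct_commutator U V \<Lambda> (adj r))))
     (nct_core U V \<Lambda>))"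

definition nct_triple ::
    "'a::cstar_algebra \<Rightarrow> 'a \<Rightarrow> ('a \<Rightarrow> 'h::complex_hilbert_space) \<Rightarrow> ('h \<times> 'h, 'h \<times> 'h) graph
      \<Rightarrow> ('a, 'h \<times> 'h) triple" where
  "nct_triple U V \<Lambda> D =
     \<lparr> algebra = nct_smooth U V,
       repr = (\<lambda>a (x, y). (left_mult \<Lambda> a x, left_mult \<Lambda> a y)),
       dirac = D \<rparr>"

end

theory Submission
  imports Defs
begin

text \<open>The commutator with the generator \<open>V\<close> separates the two triples.  Let \<open>\<lambda> = exp (2 \<pi> \<i> \<theta>)\<close>.
  Since \<open>d\<^sub>1\<close> commutes with \<open>V\<close>, since \<open>[d\<^sub>2, V] = V\<close>, and since right multiplications commute with
  left ones, \<open>[D\<^sub>0, V]\<close> has the off-diagonal entries \<open>\<i> V\<close> and \<open>- \<i> V\<close>, whereas \<open>[D, V]\<close> has the entries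
  \<open>\<i> V + [r, V]\<close> and \<open>- \<i> V + [r*, V]\<close>.  The first operator is isometric.  If \<open>W\<close> implemented a
  unitary equivalence, it would carry \<open>[D\<^sub>0, V]\<close> to \<open>[D, V]\<close>, so the second operator would be
  isometric too.  But \<open>[U\<^sup>m, V] = (1 - \<lambda> powi (- m)) U\<^sup>m V\<close>, so \<open>[D, V]\<close> sends the unit vector
  \<open>(0, 1)\<close> to \<open>(\<i> V + (1 - \<lambda> powi (- m)) U\<^sup>m V, 0)\<close>, whose squared norm is
  \<open>1 + \<bar>1 - \<lambda> powi (- m)\<bar>\<^sup>2\<close> because distinct monomials are orthonormal.  This exceeds \<open>1\<close>, since \<open>\<theta>\<close> is
  irrational and \<open>m \<noteq> 0\<close>.

  What makes the step with \<open>W\<close> rigorous is that \<open>W\<close> need not preserve the smooth core, so the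
  commutator identity is stated for the closed graphs (\<open>dirac_V\<close>) and compared using that \<open>D\<close> is
  single-valued (\<open>dirac_single_valued\<close>), which holds as \<open>D\<close> is the closure of a densely defined
  symmetric operator.  Symmetry of \<open>d\<^sub>r\<close> in the sense of the matrix entries uses that \<open>\<tau>\<close> is a trace
  (\<open>trace_commute\<close>).

  Three facts connect this with the definitions.  The operators \<open>d\<^sub>1\<close> and \<open>d\<^sub>2\<close> are the diagonal
  operators of the orthonormal basis of monomials (\<open>selfadjoint_eq_diagonal_op\<close>).  Left
  multiplication by an element of the algebra extends to a bounded operator on the completion
  (\<open>left_mult_spec\<close>).  The monomials span a dense subspace of the algebra and of the Hilbert space
  (\<open>monomials_total\<close>, \<open>basis_total\<close>), so that identities need only be checked on them.\<close>


section \<open>Complex Hilbert spaces\<close>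

lemma scaleC_zero_left [simp]: "0 *\<^sub>C (x::'a::complex_vector) = 0"
  using scaleC_of_real[of 0 x] by simp

lemma scaleC_zero_right [simp]: "c *\<^sub>C (0::'a::complex_vector) = 0"
  using scaleC_add_right[of c 0 "0::'a"] by simp

lemma scaleC_one [simp]: "1 *\<^sub>C (x::'a::complex_vector) = x"
  using scaleC_of_real[of 1 x] by simp

lemma scaleC_minus_left: "(- c) *\<^sub>C (x::'a::complex_vector) = - (c *\<^sub>C x)"
  using scaleC_add_left[of "-c" c x] by (simp add: eq_neg_iff_add_eq_0)

lemma scaleC_diff_left: "(c - d) *\<^sub>C (x::'a::complex_vector) = c *\<^sub>C x - d *\<^sub>C x"
  using scaleC_add_left[of c "- d" x] by (simp add: scaleC_minus_left)

lemma clinear_add: "clinear f \<Longrightarrow> f (x + y) = f x + f y"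
  by (simp add: clinear_def)

lemma clinear_scaleC: "clinear f \<Longrightarrow> f (c *\<^sub>C x) = c *\<^sub>C f x"
  by (simp add: clinear_def)

lemma clinear_0: "clinear f \<Longrightarrow> f 0 = 0"
  using clinear_add[of f 0 0] by simp

lemma clinear_diff:
  assumes "clinear f"
  shows "f (x - y) = f x - f y"
  using clinear_add[OF assms, of "x - y" y] by simp

lemma clinear_scaleR: "clinear f \<Longrightarrow> f (t *\<^sub>R x) = t *\<^sub>R f x"
  by (simp add: clinear_scaleC flip: scaleC_of_real)

lemma clinear_compose: "clinear f \<Longrightarrow> clinear g \<Longrightarrow> clinear (\<lambda>x. f (g x))"
  by (simp add: clinear_def)

lemma clinear_imp_bounded_linear:
  fixes f :: "'a::{complex_vector,real_normed_vector} \<Rightarrow> 'b::{complex_vector,real_normed_vector}"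
  assumes "clinear f" and "\<And>x. norm (f x) \<le> norm x * K"
  shows "bounded_linear f"
  by (rule bounded_linear_intro[where K = K])
    (use assms in \<open>auto simp: clinear_add clinear_scaleR\<close>)

lemma cinner_add_left:
  "cinner (x + y) (z::'a::complex_hilbert_space) = cinner x z + cinner y z"
  by (metis cinner_add_right cinner_commute complex_cnj_add)

lemma cinner_scaleC_left:
  "cinner (c *\<^sub>C x) (z::'a::complex_hilbert_space) = cnj c * cinner x z"
  by (metis cinner_scaleC_right cinner_commute complex_cnj_mult)

lemma cinner_zero_left [simp]: "cinner (0::'a::complex_hilbert_space) x = 0"
  using cinner_scaleC_left[of 0 0 x] by simp

lemma cinner_zero_right [simp]: "cinner (x::'a::complex_hilbert_space) 0 = 0"
  using cinner_scaleC_right[of x 0 0] by simp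

lemma cinner_diff_right:
  "cinner x (y - z) = cinner x y - cinner x (z::'a::complex_hilbert_space)"
  using cinner_add_right[of x "y - z" z] by simp

lemma cinner_self: "cinner x x = of_real ((norm (x::'a::complex_hilbert_space))\<^sup>2)"
proof (rule complex_eqI)
  show "Re (cinner x x) = Re (of_real ((norm x)\<^sup>2))"
    by (simp add: Re_cinner power2_norm_eq_inner)
  have "Im (cinner x x) = - Im (cinner x x)"
    by (subst cinner_commute) simp
  then show "Im (cinner x x) = Im (of_real ((norm x)\<^sup>2))"
    by simp
qed

lemma norm_scaleC_hilbert: "norm (c *\<^sub>C (x::'a::complex_hilbert_space)) = cmod c * norm x"
proof -
  have "complex_of_real ((norm (c *\<^sub>C x))\<^sup>2) = c * cnj c * of_real ((norm x)\<^sup>2)"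
    unfolding cinner_self[symmetric] by (simp add: cinner_scaleC_left cinner_scaleC_right)
  also have "\<dots> = complex_of_real ((cmod c * norm x)\<^sup>2)"
    by (simp add: complex_norm_square[symmetric] power_mult_distrib)
  finally have "(norm (c *\<^sub>C x))\<^sup>2 = (cmod c * norm x)\<^sup>2"
    unfolding of_real_eq_iff .
  then show ?thesis
    by simp
qed

lemma norm_unitary_op:
  assumes "unitary_op W"
  shows "norm (W x) = norm x"
proof -
  have "complex_of_real ((norm (W x))\<^sup>2) = of_real ((norm x)\<^sup>2)"
    using assms cinner_self[of "W x"] cinner_self[of x] unfolding unitary_op_def by metis
  then show ?thesis
    unfolding of_real_eq_iff by simp
qed

text \<open>Multiplying \<open>y\<close> by a phase makes \<open>cinner x y\<close> real, so the real Cauchy-Schwarz inequality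
  applies.\<close>

lemma cmod_cinner_le: "cmod (cinner x y) \<le> norm x * norm (y::'a::complex_hilbert_space)"
proof (cases "cinner x y = 0")
  case False
  define c where "c = cnj (cinner x y) / cmod (cinner x y)"
  have c: "cmod c = 1"
    using False by (simp add: c_def norm_divide)
  have "c * cinner x y = cmod (cinner x y)"
    using False
    by (simp add: c_def mult.commute[of "cnj _"] complex_norm_square[symmetric] power2_eq_square)
  then have "cmod (cinner x y) = Re (cinner x (c *\<^sub>C y))"
    by (simp add: cinner_scaleC_right)
  also have "\<dots> \<le> norm x * norm (c *\<^sub>C y)"
    by (simp add: Re_cinner norm_cauchy_schwarz)
  finally show ?thesis
    by (simp add: norm_scaleC_hilbert c)
qed simp

lemma bounded_bilinear_cinner:
  "bounded_bilinear (cinner :: 'a::complex_hilbert_space \<Rightarrow> 'a \<Rightarrow> complex)"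
proof
  show "\<exists>K. \<forall>a b :: 'a. norm (cinner a b) \<le> norm a * norm b * K"
    by (rule exI[of _ 1]) (simp add: cmod_cinner_le)
qed (simp_all add: cinner_add_left cinner_add_right cinner_scaleC_left cinner_scaleC_right
      scaleR_conv_of_real flip: scaleC_of_real)

lemmas tendsto_cinner = bounded_bilinear.tendsto[OF bounded_bilinear_cinner]
lemmas continuous_on_cinner [continuous_intros] =
  bounded_bilinear.continuous_on[OF bounded_bilinear_cinner]

lemma continuous_on_scaleC [continuous_intros]:
  fixes f :: "'a::topological_space \<Rightarrow> 'b::complex_hilbert_space"
  assumes "continuous_on S f"
  shows "continuous_on S (\<lambda>x. c *\<^sub>C f x)"
proof -
  have "clinear (\<lambda>x::'b. c *\<^sub>C x)"
    by (simp add: clinear_def scaleC_add_right scaleC_scaleC mult.commute)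
  then have "bounded_linear (\<lambda>x::'b. c *\<^sub>C x)"
    by (rule clinear_imp_bounded_linear[where K = "cmod c"]) (simp add: norm_scaleC_hilbert mult.commute)
  then show ?thesis
    using assms bounded_linear.continuous_on by blast
qed


section \<open>Total sets\<close>

definition closed_csubspace :: "'a::{complex_vector,topological_space} set \<Rightarrow> bool" where
  "closed_csubspace M \<longleftrightarrow> closed M \<and> 0 \<in> M \<and> (\<forall>x\<in>M. \<forall>y\<in>M. x + y \<in> M) \<and>
     (\<forall>c. \<forall>x\<in>M. c *\<^sub>C x \<in> M)"

text \<open>As an intersection of closed subspaces, the closed span lends itself to density arguments: a
  property holds on it as soon as it holds on the generators and defines a closed subspace.\<close>

definition closed_cspan :: "'a::{complex_vector,topological_space} set \<Rightarrow> 'a set" where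
  "closed_cspan S = \<Inter>{M. S \<subseteq> M \<and> closed_csubspace M}"

lemma closed_cspan_superset: "S \<subseteq> closed_cspan S"
  by (auto simp: closed_cspan_def)

lemma closed_cspan_subset: "S \<subseteq> M \<Longrightarrow> closed_csubspace M \<Longrightarrow> closed_cspan S \<subseteq> M"
  by (auto simp: closed_cspan_def)

lemma closed_csubspace_closed_cspan: "closed_csubspace (closed_cspan S)"
  by (auto simp: closed_cspan_def closed_csubspace_def)

lemma closed_csubspace_vimage:
  assumes "clinear f" and "continuous_on UNIV f" and M: "closed_csubspace M"
  shows "closed_csubspace (f -` M)"
proof -
  have "closed (f -` M)"
    using M assms(2) by (auto simp: closed_csubspace_def intro: closed_vimage)
  then show ?thesis
    using assms(1) M
    by (auto simp: closed_csubspace_def clinear_add clinear_scaleC clinear_0)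
qed

text \<open>Allowing any equivariance under scalars in place of linearity covers the antilinear first
  argument of an inner product.\<close>

lemma closed_csubspace_Collect_eq:
  fixes f g :: "'a::{complex_vector,topological_space} \<Rightarrow> 'b::real_normed_vector"
  assumes "continuous_on UNIV f" and "continuous_on UNIV g"
    and add: "\<And>x y. f (x + y) = f x + f y" "\<And>x y. g (x + y) = g x + g y"
    and "\<And>c x. f x = g x \<Longrightarrow> f (c *\<^sub>C x) = g (c *\<^sub>C x)"
  shows "closed_csubspace {x. f x = g x}"
proof -
  have "f 0 = 0" "g 0 = 0"
    using add(1)[of 0 0] add(2)[of 0 0] by simp_all
  then show ?thesis
    using assms by (auto simp: closed_csubspace_def intro: closed_Collect_eq)
qed

lemma eq_on_total:
  fixes f g :: "'a::{complex_vector,topological_space} \<Rightarrow> 'b::{real_normed_vector,complex_vector}"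
  assumes "closed_cspan S = UNIV"
    and "clinear f" "clinear g" "continuous_on UNIV f" "continuous_on UNIV g"
    and "\<And>x. x \<in> S \<Longrightarrow> f x = g x"
  shows "f x = g x"
proof -
  have "closed_csubspace {x. f x = g x}"
    using assms by (intro closed_csubspace_Collect_eq) (auto simp: clinear_add clinear_scaleC)
  then show ?thesis
    using closed_cspan_subset[of S "{x. f x = g x}"] assms by auto
qed

lemma orthogonal_to_total:
  fixes x :: "'a::complex_hilbert_space"
  assumes "closed_cspan S = UNIV" and "\<And>s. s \<in> S \<Longrightarrow> cinner s x = 0"
  shows "x = 0"
proof -
  have "closed_csubspace {y. cinner y x = 0}"
    by (rule closed_csubspace_Collect_eq[where g = "\<lambda>_. 0"])
      (auto intro!: continuous_intros simp: cinner_add_left cinner_scaleC_left)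
  then have "cinner x x = 0"
    using closed_cspan_subset[of S "{y. cinner y x = 0}"] assms by auto
  then show ?thesis
    by (simp add: cinner_self)
qed


section \<open>Selfadjoint diagonal operators\<close>

definition orthonormal :: "('i \<Rightarrow> 'h::complex_hilbert_space) \<Rightarrow> bool" where
  "orthonormal e \<longleftrightarrow> (\<forall>i j. cinner (e i) (e j) = (if i = j then 1 else 0))"

definition diagonal_op :: "('i \<Rightarrow> 'h::complex_hilbert_space) \<Rightarrow> ('i \<Rightarrow> real) \<Rightarrow> ('h, 'h) graph" where
  "diagonal_op e w = {(x, y). \<forall>i. cinner (e i) y = of_real (w i) * cinner (e i) x}"

definition fourier_sum :: "('i \<Rightarrow> 'h::complex_hilbert_space) \<Rightarrow> 'h \<Rightarrow> 'i set \<Rightarrow> 'h" where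
  "fourier_sum e x F = (\<Sum>i\<in>F. cinner (e i) x *\<^sub>C e i)"

lemma cinner_sum_left:
  "cinner (sum f F) (x::'a::complex_hilbert_space) = (\<Sum>i\<in>F. cinner (f i) x)"
  by (rule bounded_bilinear.sum_left[OF bounded_bilinear_cinner])

lemma cinner_sum_right:
  "cinner (x::'a::complex_hilbert_space) (sum f F) = (\<Sum>i\<in>F. cinner x (f i))"
  by (rule bounded_bilinear.sum_right[OF bounded_bilinear_cinner])

lemma fourier_sum_add: "fourier_sum e (x + y) F = fourier_sum e x F + fourier_sum e y F"
  by (simp add: fourier_sum_def cinner_add_right scaleC_add_left sum.distrib)

lemma scaleC_sum_right: "c *\<^sub>C (sum f F :: 'a::complex_vector) = (\<Sum>i\<in>F. c *\<^sub>C f i)"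
  by (induction F rule: infinite_finite_induct) (simp_all add: scaleC_add_right)

lemma fourier_sum_scaleC: "fourier_sum e (c *\<^sub>C x) F = c *\<^sub>C fourier_sum e x F"
  by (simp add: fourier_sum_def cinner_scaleC_right scaleC_sum_right scaleC_scaleC)

text \<open>Bessel's inequality: \<open>fourier_sum e x F\<close> is an orthogonal projection of \<open>x\<close>, so
  \<open>\<parallel>P x\<parallel>\<^sup>2 = \<langle>P x, x\<rangle> \<le> \<parallel>P x\<parallel> \<parallel>x\<parallel>\<close>.\<close>

lemma norm_fourier_sum_le:
  assumes "orthonormal e" and "finite F"
  shows "norm (fourier_sum e x F) \<le> norm x"
proof -
  let ?P = "fourier_sum e x F"
  have "cinner ?P (e j) = cnj (cinner (e j) x)" if "j \<in> F" for j
  proof -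
    have "cinner ?P (e j) = (\<Sum>i\<in>F. if i = j then cnj (cinner (e i) x) else 0)"
      unfolding fourier_sum_def cinner_sum_left cinner_scaleC_left
      using assms(1) by (intro sum.cong) (simp_all add: orthonormal_def)
    then show ?thesis
      using that assms(2) by simp
  qed
  then have "cinner ?P ?P = (\<Sum>j\<in>F. cinner (e j) x * cnj (cinner (e j) x))"
    by (subst (2) fourier_sum_def) (simp add: cinner_sum_right cinner_scaleC_right)
  also have "\<dots> = cinner ?P x"
    by (simp add: fourier_sum_def cinner_sum_left cinner_scaleC_left mult.commute)
  finally have "(norm ?P)\<^sup>2 = cmod (cinner ?P x)"
    using cinner_self[of ?P] by (metis norm_ge_zero norm_of_real abs_of_nonneg zero_le_power2)
  then have "norm ?P * norm ?P \<le> norm ?P * norm x"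
    using cmod_cinner_le[of ?P x] by (simp add: power2_eq_square)
  then show ?thesis
    by (cases "norm ?P = 0") (auto simp: mult_le_cancel_left)
qed

text \<open>The vectors with convergent Fourier sums form a closed subspace, because the projections are
  uniformly bounded.\<close>

lemma fourier_sum_tendsto:
  fixes e :: "'i \<Rightarrow> 'h::complex_hilbert_space"
  assumes e: "orthonormal e" and total: "closed_cspan (range e) = UNIV"
  shows "(fourier_sum e x \<longlongrightarrow> x) (finite_subsets_at_top UNIV)"
proof -
  define M where "M = {x. (fourier_sum e x \<longlongrightarrow> x) (finite_subsets_at_top UNIV)}"
  have "closed M"
  proof (rule closed_sequential_limits[THEN iffD2], intro allI impI, elim conjE)
    fix u l assume u: "\<forall>n. u n \<in> M" and lim: "u \<longlonglongrightarrow> l"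
    have "\<forall>\<^sub>F F in finite_subsets_at_top UNIV. dist (fourier_sum e l F) l < \<epsilon>" if "\<epsilon> > 0" for \<epsilon>
    proof -
      obtain n where n: "norm (u n - l) < \<epsilon> / 3"
        using LIMSEQ_D[OF lim, of "\<epsilon> / 3"] \<open>\<epsilon> > 0\<close> by auto
      have "\<forall>\<^sub>F F in finite_subsets_at_top UNIV. dist (fourier_sum e (u n) F) (u n) < \<epsilon> / 3"
        using u \<open>\<epsilon> > 0\<close> by (intro tendstoD) (auto simp: M_def)
      moreover have "\<forall>\<^sub>F F in finite_subsets_at_top UNIV. finite F"
        by (auto simp: eventually_finite_subsets_at_top)
      ultimately show ?thesis
      proof eventually_elim
        case (elim F)
        have "fourier_sum e l F - l
            = (fourier_sum e (u n) F - u n) + (u n - l) + fourier_sum e (l - u n) F"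
          using fourier_sum_add[of e "l - u n" "u n" F] by simp
        moreover have "norm (fourier_sum e (l - u n) F) \<le> norm (u n - l)"
          using norm_fourier_sum_le[OF e elim(2)] by (metis norm_minus_commute)
        ultimately have "norm (fourier_sum e l F - l)
            \<le> norm (fourier_sum e (u n) F - u n) + norm (u n - l) + norm (u n - l)"
          by (smt (verit) norm_triangle_ineq)
        then show ?case
          using elim n by (simp add: dist_norm)
      qed
    qed
    then show "l \<in> M"
      by (auto simp: M_def tendsto_iff)
  qed
  moreover have "(fourier_sum e (c *\<^sub>C x) \<longlongrightarrow> c *\<^sub>C x) (finite_subsets_at_top UNIV)" if "x \<in> M" for c x
  proof -
    have "continuous_on UNIV (\<lambda>x::'h. c *\<^sub>C x)"
      by (intro continuous_intros)
    then have "isCont (\<lambda>x. c *\<^sub>C x) x"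
      by (simp add: continuous_on_eq_continuous_at)
    then have "((\<lambda>F. c *\<^sub>C fourier_sum e x F) \<longlongrightarrow> c *\<^sub>C x) (finite_subsets_at_top UNIV)"
      using isCont_tendsto_compose that by (auto simp: M_def)
    then show ?thesis
      by (simp add: fourier_sum_scaleC[abs_def])
  qed
  moreover have "fourier_sum e 0 = (\<lambda>F. 0)"
    by (simp add: fourier_sum_def fun_eq_iff)
  moreover have "(fourier_sum e (x + y) \<longlongrightarrow> x + y) (finite_subsets_at_top UNIV)"
    if "x \<in> M" "y \<in> M" for x y
    using that by (auto simp: M_def fourier_sum_add[abs_def] intro: tendsto_add)
  ultimately have "closed_csubspace M"
    by (simp add: closed_csubspace_def M_def)
  moreover have "e i \<in> M" for i
  proof -
    have "fourier_sum e (e i) F = e i" if "finite F" "i \<in> F" for F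
    proof -
      have "fourier_sum e (e i) F = (\<Sum>j\<in>F. if j = i then e i else 0)"
        unfolding fourier_sum_def using e by (intro sum.cong) (simp_all add: orthonormal_def)
      then show ?thesis
        using that by simp
    qed
    then have "\<forall>\<^sub>F F in finite_subsets_at_top UNIV. fourier_sum e (e i) F = e i"
      unfolding eventually_finite_subsets_at_top by (intro exI[of _ "{i}"]) auto
    then show ?thesis
      by (auto simp: M_def intro: tendsto_eventually)
  qed
  ultimately have "closed_cspan (range e) \<subseteq> M"
    by (intro closed_cspan_subset) auto
  then show ?thesis
    using total by (auto simp: M_def)
qed

text \<open>On finite Fourier sums, moving the real weights from one argument of the inner product to the
  other is an identity between finite sums; the claim is its limit.\<close>

lemma diagonal_op_symmetric:
  assumes e: "orthonormal e" "closed_cspan (range e) = UNIV"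
    and T: "(x, y) \<in> diagonal_op e w" "(x', y') \<in> diagonal_op e w"
  shows "cinner x y' = cinner y x'"
proof -
  have "cinner (fourier_sum e x F) y' = cinner (fourier_sum e y F) x'" for F
    using T
    by (simp add: fourier_sum_def cinner_sum_left cinner_scaleC_left diagonal_op_def mult_ac)
  then have "((\<lambda>F. cinner (fourier_sum e y F) x') \<longlongrightarrow> cinner x y') (finite_subsets_at_top UNIV)"
    using tendsto_cinner[OF fourier_sum_tendsto[OF e] tendsto_const, of x y'] by simp
  moreover have "((\<lambda>F. cinner (fourier_sum e y F) x') \<longlongrightarrow> cinner y x') (finite_subsets_at_top UNIV)"
    by (intro tendsto_cinner fourier_sum_tendsto[OF e] tendsto_const)
  ultimately show ?thesis
    using tendsto_unique finite_subsets_at_top_neq_bot by blast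
qed

lemma diagonal_op_basis:
  assumes "orthonormal e"
  shows "(e i, of_real (w i) *\<^sub>C e i) \<in> diagonal_op e w"
  using assms by (auto simp: diagonal_op_def orthonormal_def cinner_scaleC_right)

lemma op_adjoint_antimono: "S \<subseteq> T \<Longrightarrow> op_adjoint T \<subseteq> op_adjoint S"
  by (auto simp: op_adjoint_def)

text \<open>Testing the defining condition of the adjoint on \<open>e i\<close> alone fixes the coefficient of the
  value at \<open>e i\<close>.\<close>

lemma op_adjoint_subset_diagonal_op:
  assumes "\<And>i. (e i, of_real (w i) *\<^sub>C e i) \<in> T"
  shows "op_adjoint T \<subseteq> diagonal_op e w"
proof clarify
  fix x y assume "(x, y) \<in> op_adjoint T"
  then have "cinner x (of_real (w i) *\<^sub>C e i) = cinner y (e i)" for i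
    using assms[of i] by (auto simp: op_adjoint_def)
  then have "cinner (e i) y = cnj (cinner x (of_real (w i) *\<^sub>C e i))" for i
    by (metis cinner_commute)
  then show "(x, y) \<in> diagonal_op e w"
    by (simp add: diagonal_op_def cinner_scaleC_right flip: cinner_commute)
qed

lemma closed_csubspace_closure:
  fixes D :: "'a::complex_hilbert_space set"
  assumes "0 \<in> D" "\<And>x y. x \<in> D \<Longrightarrow> y \<in> D \<Longrightarrow> x + y \<in> D" "\<And>c x. x \<in> D \<Longrightarrow> c *\<^sub>C x \<in> D"
  shows "closed_csubspace (closure D)"
proof -
  have "x + y \<in> closure D" if "x \<in> closure D" "y \<in> closure D" for x y
  proof -
    have "(\<lambda>p. fst p + snd p) ` closure (D \<times> D) \<subseteq> closure D"
      by (rule image_closure_subset)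
        (use assms(2) closure_subset[of D] in \<open>auto intro!: continuous_intros simp: subset_iff\<close>)
    then show ?thesis
      using that by (force simp: closure_Times)
  qed
  moreover have "c *\<^sub>C x \<in> closure D" if "x \<in> closure D" for c x
  proof -
    have "(\<lambda>x. c *\<^sub>C x) ` closure D \<subseteq> closure D"
      by (rule image_closure_subset)
        (use assms(3) closure_subset[of D] in \<open>auto intro!: continuous_intros simp: subset_iff\<close>)
    then show ?thesis
      using that by auto
  qed
  ultimately show ?thesis
    using assms(1) closure_subset[of D] by (auto simp: closed_csubspace_def)
qed

lemma op_selfadjoint_diagonal_op:
  assumes e: "orthonormal e" "closed_cspan (range e) = UNIV"
  shows "op_selfadjoint (diagonal_op e w)"
proof -
  let ?T = "diagonal_op e w"
  have dom: "x \<in> Domain ?T \<longleftrightarrow> (\<exists>y. \<forall>i. cinner (e i) y = of_real (w i) * cinner (e i) x)" for x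
    by (auto simp: diagonal_op_def)
  have "closed_csubspace (closure (Domain ?T))"
  proof (rule closed_csubspace_closure)
    show "0 \<in> Domain ?T"
      unfolding dom by (rule exI[of _ 0]) simp
    show "x + x' \<in> Domain ?T" if "x \<in> Domain ?T" "x' \<in> Domain ?T" for x x'
      using that unfolding dom by (metis cinner_add_right distrib_left)
    show "c *\<^sub>C x \<in> Domain ?T" if "x \<in> Domain ?T" for c x
      using that unfolding dom by (metis cinner_scaleC_right mult.left_commute)
  qed
  moreover have "range e \<subseteq> closure (Domain ?T)"
    using diagonal_op_basis[OF e(1)] closure_subset[of "Domain ?T"] by blast
  ultimately have "closure (Domain ?T) = UNIV"
    using closed_cspan_subset e(2) by blast
  moreover have "op_adjoint ?T \<subseteq> ?T"
    by (rule op_adjoint_subset_diagonal_op) (rule diagonal_op_basis[OF e(1)])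
  moreover have "?T \<subseteq> op_adjoint ?T"
    using diagonal_op_symmetric[OF e, of _ _ w] by (auto simp: op_adjoint_def)
  ultimately show ?thesis
    by (auto simp: op_selfadjoint_def)
qed

text \<open>Adjoints reverse inclusions.  A selfadjoint \<open>T\<close> with the prescribed eigenvectors is therefore
  contained in the diagonal operator, and since both are selfadjoint the reverse inclusion follows.
  Hence eigenvalues on an orthonormal basis determine a selfadjoint operator.\<close>

lemma selfadjoint_eq_diagonal_op:
  assumes e: "orthonormal e" "closed_cspan (range e) = UNIV"
  shows "(THE T. op_selfadjoint T \<and> (\<forall>i. (e i, of_real (w i) *\<^sub>C e i) \<in> T)) = diagonal_op e w"
proof (rule the_equality)
  show "op_selfadjoint (diagonal_op e w) \<and> (\<forall>i. (e i, of_real (w i) *\<^sub>C e i) \<in> diagonal_op e w)"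
    using op_selfadjoint_diagonal_op[OF e] diagonal_op_basis[OF e(1)] by blast
next
  fix T assume T: "op_selfadjoint T \<and> (\<forall>i. (e i, of_real (w i) *\<^sub>C e i) \<in> T)"
  then have "T \<subseteq> diagonal_op e w"
    using op_adjoint_subset_diagonal_op[of e w T] by (simp add: op_selfadjoint_def)
  moreover from op_adjoint_antimono[OF this] have "diagonal_op e w \<subseteq> T"
    using T op_selfadjoint_diagonal_op[OF e, of w] by (simp add: op_selfadjoint_def)
  ultimately show "T = diagonal_op e w"
    by blast
qed


section \<open>Unitary elements of a C*-algebra\<close>

lemma adj_zero [simp]: "adj (0::'a::cstar_algebra) = 0"
  using adj_add[of 0 "0::'a"] by simp

lemma adj_one [simp]: "adj (1::'a::cstar_algebra) = 1"
  by (metis adj_adj adj_mult mult.left_neutral mult_1_right)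

lemma adj_minus: "adj (- x) = - adj (x::'a::cstar_algebra)"
  using adj_add[of x "- x"] by (simp add: eq_neg_iff_add_eq_0 add.commute)

lemma adj_diff: "adj (x - y) = adj x - adj (y::'a::cstar_algebra)"
  using adj_add[of x "- y"] by (simp add: adj_minus)

lemma adj_power: "adj (x ^ n) = adj (x::'a::cstar_algebra) ^ n"
  by (induction n) (simp_all add: adj_mult power_commutes)

lemma norm_adj: "norm (adj x) = norm (x::'a::cstar_algebra)"
proof -
  have le: "norm y \<le> norm (adj y)" for y :: 'a
  proof (cases "y = 0")
    case False
    have "norm y * norm y \<le> norm (adj y) * norm y"
      using cstar_identity[of y] norm_mult_ineq[of "adj y" y] by (simp add: power2_eq_square)
    then show ?thesis
      using False by simp
  qed simp
  from le[of x] le[of "adj x"] show ?thesis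
    by (simp add: adj_adj)
qed

lemma continuous_on_adj: "continuous_on UNIV (adj :: 'a::cstar_algebra \<Rightarrow> 'a)"
  unfolding continuous_on_iff
  by (metis adj_diff dist_norm norm_adj)

lemma clinear_mult_left: "clinear (\<lambda>x. a * (x::'a::cstar_algebra))"
  by (simp add: clinear_def distrib_left mult_scaleC_right)

lemma clinear_mult_right: "clinear (\<lambda>x. x * (a::'a::cstar_algebra))"
  by (simp add: clinear_def distrib_right mult_scaleC_left)

lemma unitary_elem_cancel:
  assumes "unitary_elem u"
  shows "adj u * (u * x) = x" "u * (adj u * x) = x"
  using assms by (simp_all add: unitary_elem_def flip: mult.assoc)

lemma upow_0 [simp]: "upow u 0 = 1"
  by (simp add: upow_def)

lemma upow_1 [simp]: "upow u 1 = u"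
  by (simp add: upow_def)

lemma upow_uminus: "upow u (- n) = adj (upow (u::'a::cstar_algebra) n)"
  by (auto simp: upow_def adj_power adj_adj)

lemma upow_add_1:
  assumes u: "unitary_elem u"
  shows "upow u (n + 1) = upow u n * u"
proof (cases "n \<ge> 0")
  case True
  then show ?thesis
    by (simp add: upow_def nat_add_distrib power_commutes)
next
  case False
  then obtain k where k: "n = - int (Suc k)"
    by (metis int_cases not_le of_nat_0_le_iff)
  have neg: "upow u (- int j) = adj u ^ j" for j
    by (simp add: upow_uminus upow_def adj_power)
  have "adj u ^ Suc k * u = adj u ^ k"
    using u by (simp add: unitary_elem_def power_Suc2 mult.assoc del: power_Suc)
  moreover have "n + 1 = - int k"
    by (simp add: k)
  ultimately show ?thesis
    by (metis k neg)
qed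

lemma upow_diff_1:
  assumes u: "unitary_elem u"
  shows "upow u (n - 1) = upow u n * adj u"
  using upow_add_1[OF u, of "n - 1"] u by (simp add: unitary_elem_def mult.assoc)

lemma upow_add:
  assumes u: "unitary_elem u"
  shows "upow u (m + n) = upow u m * upow u n"
proof (induction n rule: int_induct[where k = 0])
  case (step1 i)
  then show ?case
    using upow_add_1[OF u, of "m + i"] upow_add_1[OF u, of i] by (simp add: add.assoc mult.assoc)
next
  case (step2 i)
  then show ?case
    using upow_diff_1[OF u, of "m + i"] upow_diff_1[OF u, of i]
    by (simp add: diff_conv_add_uminus add.assoc mult.assoc del: add_uminus_conv_diff)
qed simp

text \<open>Applied to each factor in turn, the next three lemmas turn \<open>U V = \<lambda> V U\<close> into a relation
  between \<open>U\<^sup>p\<close> and \<open>V\<^sup>q\<close> with the phase \<open>\<lambda> powi (p * q)\<close>; multiplying the relation by an adjoint on both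
  sides yields the negative exponents.\<close>

lemma scaled_commute_adj:
  assumes v: "unitary_elem v" and c: "c \<noteq> 0" and comm: "x * v = c *\<^sub>C (v * (x::'a::cstar_algebra))"
  shows "x * adj v = inverse c *\<^sub>C (adj v * x)"
proof -
  have "adj v * x = adj v * (x * v) * adj v"
    using v by (simp add: unitary_elem_def mult.assoc)
  also have "\<dots> = c *\<^sub>C (x * adj v)"
    using unitary_elem_cancel[OF v]
    by (simp add: comm mult_scaleC_left mult_scaleC_right flip: mult.assoc)
  finally show ?thesis
    using c by (simp add: scaleC_scaleC)
qed

lemma scaled_commute_upow_right:
  assumes v: "unitary_elem v" and c: "c \<noteq> 0" and comm: "x * v = c *\<^sub>C (v * (x::'a::cstar_algebra))"
  shows "x * upow v n = (c powi n) *\<^sub>C (upow v n * x)"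
proof (induction n rule: int_induct[where k = 0])
  case (step1 i)
  have "x * upow v (i + 1) = (x * upow v i) * v"
    by (simp add: upow_add_1[OF v] mult.assoc)
  also have "\<dots> = (c powi i * c) *\<^sub>C (upow v i * v * x)"
    unfolding step1 by (simp add: mult_scaleC_left mult_scaleC_right mult.assoc comm scaleC_scaleC)
  finally show ?case
    using c by (simp add: power_int_add_1 upow_add_1[OF v])
next
  case (step2 i)
  have "x * upow v (i - 1) = (x * upow v i) * adj v"
    by (simp add: upow_diff_1[OF v] mult.assoc)
  also have "\<dots> = (c powi i * inverse c) *\<^sub>C (upow v i * adj v * x)"
    unfolding step2 using scaled_commute_adj[OF v c comm]
    by (simp add: mult_scaleC_left mult_scaleC_right mult.assoc scaleC_scaleC)
  finally show ?case
    using c by (simp add: power_int_diff divide_inverse upow_diff_1[OF v])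
qed simp

lemma scaled_commute_upow_left:
  assumes v: "unitary_elem v" and c: "c \<noteq> 0" and comm: "v * x = c *\<^sub>C (x * (v::'a::cstar_algebra))"
  shows "upow v n * x = (c powi n) *\<^sub>C (x * upow v n)"
proof -
  have "x * v = inverse c *\<^sub>C (v * x)"
    using c by (simp add: comm scaleC_scaleC)
  from scaled_commute_upow_right[OF v _ this, of n] c
  have "x * upow v n = inverse (c powi n) *\<^sub>C (upow v n * x)"
    by (simp add: power_int_inverse)
  then show ?thesis
    using c by (simp add: scaleC_scaleC)
qed


section \<open>The GNS representation\<close>

text \<open>Positivity of \<open>\<tau>\<close> is implicit: \<open>\<tau> (a* a)\<close> is the squared norm of \<open>\<Lambda> a\<close>.\<close>

locale gns =
  fixes \<tau> :: "'a::cstar_algebra \<Rightarrow> complex"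
    and \<Lambda> :: "'a \<Rightarrow> 'h::complex_hilbert_space"
  assumes clinear_functional: "clinear \<tau>"
    and bounded_functional: "bounded_linear \<tau>"
    and L2: "L2_space \<tau> \<Lambda>"
begin

lemma clinear_Lambda: "clinear \<Lambda>"
  using L2 by (simp add: L2_space_def)

lemma cinner_Lambda: "cinner (\<Lambda> a) (\<Lambda> b) = \<tau> (adj a * b)"
  using L2 by (simp add: L2_space_def)

lemma dense_Lambda: "closure (range \<Lambda>) = UNIV"
  using L2 by (simp add: L2_space_def)

lemmas Lambda_add = clinear_add[OF clinear_Lambda]
lemmas Lambda_diff = clinear_diff[OF clinear_Lambda]
lemmas Lambda_scaleC = clinear_scaleC[OF clinear_Lambda]
lemmas Lambda_0 = clinear_0[OF clinear_Lambda]

lemma norm_Lambda_bound: "\<exists>K>0. \<forall>a. norm (\<Lambda> a) \<le> norm a * K"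
proof -
  obtain K where K: "K > 0" "\<And>a. norm (\<tau> a) \<le> norm a * K"
    using bounded_linear.pos_bounded[OF bounded_functional] by blast
  have "norm (\<Lambda> a) \<le> norm a * sqrt K" for a
  proof -
    have "(norm (\<Lambda> a))\<^sup>2 = norm (cinner (\<Lambda> a) (\<Lambda> a))"
      by (simp add: cinner_self norm_power)
    also have "\<dots> \<le> norm (adj a * a) * K"
      unfolding cinner_Lambda by (rule K)
    also have "\<dots> = (norm a * sqrt K)\<^sup>2"
      using K by (simp add: cstar_identity power_mult_distrib)
    finally show ?thesis
      by (rule power2_le_imp_le) (use K(1) in auto)
  qed
  then show ?thesis
    using K(1) by (intro exI[of _ "sqrt K"]) auto
qed

lemma bounded_linear_Lambda: "bounded_linear \<Lambda>"
  using norm_Lambda_bound clinear_imp_bounded_linear[OF clinear_Lambda] by blast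

lemma continuous_on_Lambda: "continuous_on UNIV \<Lambda>"
  by (rule linear_continuous_on[OF bounded_linear_Lambda])

lemma cinner_Lambda_mult: "cinner (\<Lambda> a) (\<Lambda> (b * c)) = cinner (\<Lambda> (adj b * a)) (\<Lambda> c)"
  by (simp add: cinner_Lambda adj_mult adj_adj mult.assoc)

text \<open>For selfadjoint \<open>c\<close> the numbers \<open>x n = \<parallel>\<Lambda> (c ^ (2 ^ n) * b)\<parallel>\<close> satisfy
  \<open>x n ^ 2 \<le> \<parallel>\<Lambda> b\<parallel> * x (n + 1)\<close> by Cauchy-Schwarz.  Iterating gives
  \<open>(x 0 / \<parallel>\<Lambda> b\<parallel>) ^ (2 ^ n) \<le> x n / \<parallel>\<Lambda> b\<parallel> \<le> C * \<parallel>c\<parallel> ^ (2 ^ n)\<close>, and letting \<open>n\<close> grow removes the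
  constant \<open>C\<close>, although it depends on \<open>b\<close>.\<close>

lemma norm_Lambda_mult_selfadjoint_le:
  assumes c: "adj c = c"
  shows "norm (\<Lambda> (c * b)) \<le> norm c * norm (\<Lambda> b)"
proof (rule ccontr)
  assume "\<not> norm (\<Lambda> (c * b)) \<le> norm c * norm (\<Lambda> b)"
  then have gt: "norm (\<Lambda> (c * b)) > norm c * norm (\<Lambda> b)"
    by simp
  define x where "x n = norm (\<Lambda> (c ^ (2 ^ n) * b))" for n :: nat
  have cs: "(x n)\<^sup>2 \<le> norm (\<Lambda> b) * x (Suc n)" for n
  proof -
    have "(x n)\<^sup>2 = norm (cinner (\<Lambda> (c ^ (2 ^ n) * b)) (\<Lambda> (c ^ (2 ^ n) * b)))"
      by (simp add: x_def cinner_self norm_power)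
    also have "\<dots> = norm (cinner (\<Lambda> b) (\<Lambda> (c ^ (2 ^ Suc n) * b)))"
      unfolding cinner_Lambda
      by (simp add: adj_mult adj_power c mult_2 power_add mult.assoc)
    also have "\<dots> \<le> norm (\<Lambda> b) * x (Suc n)"
      unfolding x_def by (rule cmod_cinner_le)
    finally show ?thesis .
  qed
  have b: "norm (\<Lambda> b) > 0"
  proof (rule ccontr)
    assume "\<not> norm (\<Lambda> b) > 0"
    then have "\<Lambda> b = 0"
      by simp
    with cs[of 0] gt show False
      by (simp add: x_def)
  qed
  define y where "y n = x n / norm (\<Lambda> b)" for n
  have y: "y n \<ge> 0" "(y n)\<^sup>2 \<le> y (Suc n)" for n
    using cs[of n] b by (simp_all add: y_def x_def power_divide power2_eq_square divide_simps mult.commute)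
  have iterate: "y 0 ^ (2 ^ n) \<le> y n" for n
  proof (induction n)
    case (Suc n)
    have "y 0 ^ (2 ^ Suc n) = (y 0 ^ (2 ^ n))\<^sup>2"
      by (simp add: mult.commute flip: power_mult)
    also have "\<dots> \<le> (y n)\<^sup>2"
      using Suc y by (intro power_mono) auto
    finally show ?case
      using y(2)[of n] by linarith
  qed simp
  obtain K where K: "K > 0" "\<And>a. norm (\<Lambda> a) \<le> norm a * K"
    using norm_Lambda_bound by blast
  define C where "C = norm b * K / norm (\<Lambda> b)"
  have upper: "y n \<le> norm c ^ (2 ^ n) * C" for n
  proof -
    have "x n \<le> norm (c ^ (2 ^ n) * b) * K"
      unfolding x_def by (rule K)
    also have "norm (c ^ (2 ^ n) * b) \<le> norm c ^ (2 ^ n) * norm b"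
      by (rule order_trans[OF norm_mult_ineq]) (simp add: mult_right_mono norm_power_ineq)
    finally show ?thesis
      using K(1) b by (simp add: y_def C_def divide_right_mono mult_right_mono mult.assoc)
  qed
  define q where "q = y 0 / norm c"
  have c0: "norm c > 0"
  proof (rule ccontr)
    assume "\<not> norm c > 0"
    then show False
      using gt by (simp add: Lambda_0)
  qed
  have "q > 1"
    using gt c0 b by (simp add: q_def y_def x_def less_divide_eq mult.commute)
  then obtain N where N: "C < q ^ N"
    using real_arch_pow by blast
  have "q ^ N \<le> q ^ (2 ^ N)"
    using \<open>q > 1\<close> by (intro power_increasing) (auto simp: less_imp_le less_exp)
  also have "\<dots> = y 0 ^ (2 ^ N) / norm c ^ (2 ^ N)"
    by (simp add: q_def power_divide)
  also have "\<dots> \<le> (norm c ^ (2 ^ N) * C) / norm c ^ (2 ^ N)"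
    using iterate[of N] upper[of N] by (intro divide_right_mono) auto
  also have "\<dots> = C"
    using c0 by simp
  finally show False
    using N by simp
qed

text \<open>The selfadjoint case applies to \<open>a* a\<close>.\<close>

lemma norm_Lambda_mult_le: "norm (\<Lambda> (a * b)) \<le> norm a * norm (\<Lambda> b)"
proof -
  have "(norm (\<Lambda> (a * b)))\<^sup>2 = norm (cinner (\<Lambda> b) (\<Lambda> (adj a * a * b)))"
    using cinner_self[of "\<Lambda> (a * b)"] cinner_Lambda_mult[of "a * b" a b]
      cinner_Lambda_mult[of b "adj a" "a * b"]
    by (simp add: adj_adj mult.assoc norm_power)
  also have "\<dots> \<le> norm (\<Lambda> b) * norm (\<Lambda> (adj a * a * b))"
    by (rule cmod_cinner_le)
  also have "\<dots> \<le> norm (\<Lambda> b) * (norm (adj a * a) * norm (\<Lambda> b))"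
    by (intro mult_left_mono norm_Lambda_mult_selfadjoint_le) (simp_all add: adj_mult adj_adj)
  also have "\<dots> = (norm a * norm (\<Lambda> b))\<^sup>2"
    by (simp add: cstar_identity power2_eq_square)
  finally show ?thesis
    by (rule power2_le_imp_le) simp
qed

lemma closed_property_on_Lambda:
  assumes "closed {x. P x}" and "\<And>b. P (\<Lambda> b)"
  shows "P x"
proof -
  have "closure (range \<Lambda>) \<subseteq> {x. P x}"
    using assms by (intro closure_minimal) auto
  then show ?thesis
    by (auto simp: dense_Lambda)
qed

text \<open>The bound makes \<open>\<Lambda> b \<mapsto> \<Lambda> (a * b)\<close> well defined, as elements killed by
  \<open>\<Lambda>\<close> stay so after left multiplication, and uniformly continuous, so that it extends to the completion.\<close>

lemma ex_left_mult:
  "\<exists>T. clinear T \<and> bounded_linear T \<and> (\<forall>b. T (\<Lambda> b) = \<Lambda> (a * b))"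
proof -
  define f where "f x = \<Lambda> (a * (SOME b. \<Lambda> b = x))" for x
  have f: "f (\<Lambda> b) = \<Lambda> (a * b)" for b
  proof -
    have "\<Lambda> (SOME b'. \<Lambda> b' = \<Lambda> b) = \<Lambda> b"
      by (rule someI) (rule refl)
    then have "\<Lambda> ((SOME b'. \<Lambda> b' = \<Lambda> b) - b) = 0"
      by (simp add: Lambda_diff)
    then have "\<Lambda> (a * ((SOME b'. \<Lambda> b' = \<Lambda> b) - b)) = 0"
      using norm_Lambda_mult_le[of a "(SOME b'. \<Lambda> b' = \<Lambda> b) - b"] by simp
    then show ?thesis
      by (simp add: f_def right_diff_distrib Lambda_diff)
  qed
  have lip: "dist (f x) (f y) \<le> norm a * dist x y" if "x \<in> range \<Lambda>" "y \<in> range \<Lambda>" for x y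
  proof -
    obtain b c where "x = \<Lambda> b" "y = \<Lambda> c"
      using \<open>x \<in> range \<Lambda>\<close> \<open>y \<in> range \<Lambda>\<close> by blast
    then show ?thesis
      using norm_Lambda_mult_le[of a "b - c"]
      by (simp add: f dist_norm right_diff_distrib Lambda_diff)
  qed
  have "(norm a)-lipschitz_on (range \<Lambda>) f"
    using lip by (auto intro!: lipschitz_onI)
  then have "uniformly_continuous_on (range \<Lambda>) f"
    by (rule lipschitz_on_uniformly_continuous)
  then obtain g where "uniformly_continuous_on (closure (range \<Lambda>)) g"
    and gf: "\<And>x. x \<in> range \<Lambda> \<Longrightarrow> f x = g x"
    using uniformly_continuous_on_extension_on_closure[of "range \<Lambda>" f] by metis
  then have cont: "continuous_on UNIV g"
    by (simp add: dense_Lambda uniformly_continuous_imp_continuous)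
  have cont_g: "continuous_on UNIV (\<lambda>x. g (h x))" if "continuous_on UNIV h"
    for h :: "'c::topological_space \<Rightarrow> 'h"
    using continuous_on_compose2[OF cont that] by simp
  have g: "g (\<Lambda> b) = \<Lambda> (a * b)" for b
    using gf[of "\<Lambda> b"] f[of b] by simp
  have "g (x + y) = g x + g y" for x y
  proof (rule closed_property_on_Lambda[where x = x])
    show "closed {x. g (x + y) = g x + g y}"
      by (intro closed_Collect_eq continuous_intros cont_g)
    show "g (\<Lambda> b + y) = g (\<Lambda> b) + g y" for b
    proof (rule closed_property_on_Lambda[where x = y])
      show "closed {y. g (\<Lambda> b + y) = g (\<Lambda> b) + g y}"
        by (intro closed_Collect_eq continuous_intros cont_g)
      show "g (\<Lambda> b + \<Lambda> c) = g (\<Lambda> b) + g (\<Lambda> c)" for c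
        by (simp add: g distrib_left flip: Lambda_add)
    qed
  qed
  moreover have "g (c *\<^sub>C x) = c *\<^sub>C g x" for c x
  proof (rule closed_property_on_Lambda[where x = x])
    show "closed {x. g (c *\<^sub>C x) = c *\<^sub>C g x}"
      by (intro closed_Collect_eq continuous_intros cont_g)
    show "g (c *\<^sub>C \<Lambda> b) = c *\<^sub>C g (\<Lambda> b)" for b
      by (simp add: g mult_scaleC_right flip: Lambda_scaleC)
  qed
  ultimately have "clinear g"
    by (simp add: clinear_def)
  moreover have "norm (g x) \<le> norm x * norm a" for x
  proof (rule closed_property_on_Lambda[where x = x])
    show "closed {x. norm (g x) \<le> norm x * norm a}"
      by (intro closed_Collect_le continuous_intros cont_g)
    show "norm (g (\<Lambda> b)) \<le> norm (\<Lambda> b) * norm a" for b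
      using norm_Lambda_mult_le[of a b] by (simp add: g mult.commute)
  qed
  ultimately show ?thesis
    using g clinear_imp_bounded_linear by blast
qed

lemma left_mult_spec:
  "clinear (left_mult \<Lambda> a) \<and> bounded_linear (left_mult \<Lambda> a) \<and>
     (\<forall>b. left_mult \<Lambda> a (\<Lambda> b) = \<Lambda> (a * b))"
proof -
  have "\<exists>!T. clinear T \<and> bounded_linear T \<and> (\<forall>b. T (\<Lambda> b) = \<Lambda> (a * b))"
  proof (rule ex_ex1I[OF ex_left_mult])
    fix S T
    assume S: "clinear S \<and> bounded_linear S \<and> (\<forall>b. S (\<Lambda> b) = \<Lambda> (a * b))"
      and T: "clinear T \<and> bounded_linear T \<and> (\<forall>b. T (\<Lambda> b) = \<Lambda> (a * b))"
    have "S x = T x" for x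
      by (rule closed_property_on_Lambda[where x = x], intro closed_Collect_eq linear_continuous_on)
        (use S T in auto)
    then show "S = T" ..
  qed
  then show ?thesis
    unfolding left_mult_def by (rule theI')
qed

lemma clinear_left_mult: "clinear (left_mult \<Lambda> a)"
  and bounded_linear_left_mult: "bounded_linear (left_mult \<Lambda> a)"
  and left_mult_Lambda: "left_mult \<Lambda> a (\<Lambda> b) = \<Lambda> (a * b)"
  using left_mult_spec by auto

lemma continuous_on_left_mult [continuous_intros]:
  "continuous_on S f \<Longrightarrow> continuous_on S (\<lambda>x. left_mult \<Lambda> a (f x))"
  by (rule bounded_linear.continuous_on[OF bounded_linear_left_mult])

lemma cinner_left_mult: "cinner (\<Lambda> b) (left_mult \<Lambda> a x) = cinner (\<Lambda> (adj a * b)) x"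
  by (rule closed_property_on_Lambda[where x = x])
    (auto intro!: closed_Collect_eq continuous_intros simp: left_mult_Lambda cinner_Lambda_mult)

lemma norm_left_mult_unitary:
  assumes "unitary_elem u"
  shows "norm (left_mult \<Lambda> u x) = norm x"
proof (rule closed_property_on_Lambda[where x = x])
  show "closed {x. norm (left_mult \<Lambda> u x) = norm x}"
    by (intro closed_Collect_eq continuous_intros)
  show "norm (left_mult \<Lambda> u (\<Lambda> b)) = norm (\<Lambda> b)" for b
  proof -
    have "complex_of_real ((norm (\<Lambda> (u * b)))\<^sup>2) = of_real ((norm (\<Lambda> b))\<^sup>2)"
      unfolding cinner_self[symmetric]
      by (simp add: cinner_Lambda_mult unitary_elem_cancel[OF assms])
    then show ?thesis
      unfolding of_real_eq_iff by (simp add: left_mult_Lambda)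
  qed
qed

end


section \<open>Monomials in the noncommutative torus\<close>

definition monomial :: "'a::cstar_algebra \<Rightarrow> 'a \<Rightarrow> int \<times> int \<Rightarrow> 'a" where
  "monomial U V = (\<lambda>(p, q). upow U p * upow V q)"

lemma nct_series_eq: "nct_series U V a = (\<Sum>\<^sub>\<infinity>i\<in>UNIV. a i *\<^sub>C monomial U V i)"
  by (simp add: nct_series_def monomial_def case_prod_unfold)

lemma nct_series_single: "nct_series U V (\<lambda>j. if j = i then 1 else 0) = monomial U V i"
proof -
  have "nct_series U V (\<lambda>j. if j = i then 1 else 0)
      = (\<Sum>\<^sub>\<infinity>j\<in>{i}. (if j = i then 1 else 0) *\<^sub>C monomial U V j)"
    unfolding nct_series_eq by (rule infsum_cong_neutral) auto
  then show ?thesis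
    by simp
qed

lemma rapidly_decreasing_single: "rapidly_decreasing (\<lambda>j. if j = i then 1 else 0)"
  unfolding rapidly_decreasing_def
proof (intro allI bdd_aboveI2)
  fix k l :: nat and x :: "int \<times> int"
  show "(\<lambda>(p, q). cmod (of_int p ^ k * of_int q ^ l * (if (p, q) = i then 1 else 0))) x
      \<le> cmod (of_int (fst i) ^ k * of_int (snd i) ^ l)"
    by (cases x) auto
qed

lemma monomial_smooth: "monomial U V i \<in> nct_smooth U V"
  unfolding nct_smooth_def using nct_series_single[of U V i] rapidly_decreasing_single[of i] by force

lemma zero_smooth: "0 \<in> nct_smooth U V"
proof -
  have "rapidly_decreasing (\<lambda>_. 0)" and "nct_series U V (\<lambda>_. 0) = 0"
    by (auto simp: rapidly_decreasing_def nct_series_def case_prod_unfold)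
  then show ?thesis
    unfolding nct_smooth_def by force
qed

text \<open>Polynomial weights grow by a bounded factor under a shift of the index:
  \<open>\<bar>q + 1\<bar> ^ l \<le> 2 ^ l * (\<bar>q\<bar> ^ l + 1)\<close>.  The scalars \<open>c p\<close> are the phases that appear when a generator is moved past a monomial.\<close>

lemma rapidly_decreasing_shift:
  assumes a: "rapidly_decreasing a" and c: "\<And>p. cmod (c p) \<le> 1"
  shows "rapidly_decreasing (\<lambda>(p, q). c p * a (p, q - 1))"
  unfolding rapidly_decreasing_def
proof (intro allI)
  fix k l :: nat
  obtain A where A: "\<And>p q. cmod (of_int p ^ k * of_int q ^ l * a (p, q)) \<le> A"
    using a unfolding rapidly_decreasing_def bdd_above_def by fast
  obtain B where B: "\<And>p q. cmod (of_int p ^ k * of_int q ^ 0 * a (p, q)) \<le> B"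
    using a unfolding rapidly_decreasing_def bdd_above_def by fast
  show "bdd_above (range (\<lambda>(p, q). cmod (of_int p ^ k * of_int q ^ l *
      (case (p, q) of (p, q) \<Rightarrow> c p * a (p, q - 1)))))"
  proof (rule bdd_aboveI2, clarsimp split: prod.splits)
    fix p q :: int
    let ?r = "real_of_int (q - 1)"
    have "\<bar>real_of_int q\<bar> \<le> 2 * max \<bar>?r\<bar> 1"
      by (simp add: max_def abs_if)
    then have "\<bar>real_of_int q\<bar> ^ l \<le> (2 * max \<bar>?r\<bar> 1) ^ l"
      by (rule power_mono) simp
    also have "\<dots> = 2 ^ l * max \<bar>?r\<bar> 1 ^ l"
      by (simp add: power_mult_distrib)
    also have "max \<bar>?r\<bar> 1 ^ l \<le> \<bar>?r\<bar> ^ l + 1"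
      by (auto simp: max_def)
    finally have q: "\<bar>real_of_int q\<bar> ^ l \<le> 2 ^ l * (\<bar>?r\<bar> ^ l + 1)"
      by simp
    let ?t = "\<bar>real_of_int p\<bar> ^ k * cmod (a (p, q - 1))"
    have "cmod (of_int p ^ k * of_int q ^ l * (c p * a (p, q - 1)))
        = cmod (c p) * (\<bar>real_of_int q\<bar> ^ l * ?t)"
      by (simp add: norm_mult norm_power mult_ac)
    also have "\<dots> \<le> 1 * ((2 ^ l * (\<bar>?r\<bar> ^ l + 1)) * ?t)"
      by (intro mult_mono mult_right_mono q c mult_nonneg_nonneg) auto
    also have "\<dots> = 2 ^ l * (\<bar>?r\<bar> ^ l * ?t + ?t)"
      by (simp add: algebra_simps)
    also have "\<dots> \<le> 2 ^ l * (A + B)"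
    proof (intro mult_left_mono add_mono)
      have n: "cmod (of_int (q - 1)) = \<bar>?r\<bar>"
        by (rule norm_of_int)
      have "cmod (of_int p ^ k * of_int (q - 1) ^ l * a (p, q - 1)) = \<bar>?r\<bar> ^ l * ?t"
        unfolding norm_mult norm_power n by (simp add: mult_ac)
      then show "\<bar>?r\<bar> ^ l * ?t \<le> A"
        using A[of p "q - 1"] by simp
      show "?t \<le> B"
        using B[of p "q - 1"] by (simp add: norm_mult norm_power)
    qed simp
    finally show "cmod (of_int p ^ k * of_int q ^ l * (c p * a (p, q - 1))) \<le> 2 ^ l * (A + B)" .
  qed
qed

locale nc_torus_gns = gns \<tau> \<Lambda>
  for \<tau> :: "'a::cstar_algebra \<Rightarrow> complex" and \<Lambda> :: "'a \<Rightarrow> 'h::complex_hilbert_space" +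
  fixes \<theta> :: real and U V :: 'a
  assumes torus: "nc_torus \<theta> U V" and trace: "nct_trace U V \<tau>"
begin

definition rot :: complex where
  "rot = exp (2 * of_real pi * \<i> * of_real \<theta>)"

abbreviation mon :: "int \<times> int \<Rightarrow> 'a" where
  "mon \<equiv> monomial U V"

definition basis :: "int \<times> int \<Rightarrow> 'h" where
  "basis i = \<Lambda> (mon i)"

lemma unitary_U: "unitary_elem U" and unitary_V: "unitary_elem V"
  and UV: "U * V = rot *\<^sub>C (V * U)"
  using torus by (simp_all add: nc_torus_def rot_def)

lemma rot_nonzero: "rot \<noteq> 0"
  by (simp add: rot_def)

lemma norm_rot: "cmod rot = 1"
  using norm_exp_i_times[of "2 * pi * \<theta>"] by (simp add: rot_def mult_ac)

lemma upow_V_upow_U: "upow V q * upow U p = (rot powi (- (p * q))) *\<^sub>C mon (p, q)"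
proof -
  have "upow U p * V = (rot powi p) *\<^sub>C (V * upow U p)"
    by (rule scaled_commute_upow_left[OF unitary_U rot_nonzero UV])
  from scaled_commute_upow_right[OF unitary_V _ this, of q]
  have "mon (p, q) = (rot powi (p * q)) *\<^sub>C (upow V q * upow U p)"
    by (simp add: rot_nonzero monomial_def power_int_mult)
  then show ?thesis
    using rot_nonzero by (simp add: scaleC_scaleC power_int_minus)
qed

lemma mon_mult: "mon (p, q) * mon (k, l) = (rot powi (- (k * q))) *\<^sub>C mon (p + k, q + l)"
proof -
  have "mon (p, q) * mon (k, l) = upow U p * (upow V q * upow U k) * upow V l"
    by (simp add: monomial_def mult.assoc)
  also have "\<dots> = (rot powi (- (k * q))) *\<^sub>C mon (p + k, q + l)"
    unfolding upow_V_upow_U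
    by (simp add: monomial_def mult_scaleC_left mult_scaleC_right mult.assoc
        upow_add[OF unitary_U] upow_add[OF unitary_V])
  finally show ?thesis .
qed

lemma adj_mon: "adj (mon (p, q)) = (rot powi (- (p * q))) *\<^sub>C mon (- p, - q)"
  using upow_V_upow_U[of "- q" "- p"] by (simp add: monomial_def adj_mult flip: upow_uminus)

lemma mon_0: "mon (0, 0) = 1" and mon_U: "mon (1, 0) = U" and mon_V: "mon (0, 1) = V"
  by (simp_all add: monomial_def)

text \<open>The closed linear span of the monomials is a C*-algebra containing both generators.\<close>

lemma monomials_total: "closed_cspan (range mon) = UNIV"
proof -
  let ?M = "closed_cspan (range mon)"
  have M: "closed_csubspace ?M"
    by (rule closed_csubspace_closed_cspan)
  have mon: "mon i \<in> ?M" for i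
    using closed_cspan_superset[of "range mon"] by blast
  have scale: "c *\<^sub>C x \<in> ?M" if "x \<in> ?M" for c x
    using M that by (simp add: closed_csubspace_def)
  have mult_mon: "x * mon i \<in> ?M" if "x \<in> ?M" for x i
  proof -
    have "closed_csubspace ((\<lambda>x. x * mon i) -` ?M)"
      by (intro closed_csubspace_vimage clinear_mult_right M continuous_intros)
    moreover have "range mon \<subseteq> (\<lambda>x. x * mon i) -` ?M"
      by (cases i) (auto simp: mon_mult scale mon)
    ultimately show ?thesis
      using closed_cspan_subset that by blast
  qed
  have mult: "x * y \<in> ?M" if "x \<in> ?M" "y \<in> ?M" for x y
  proof -
    have "closed_csubspace ((*) x -` ?M)"
      by (intro closed_csubspace_vimage clinear_mult_left M continuous_intros)
    moreover have "range mon \<subseteq> (*) x -` ?M"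
      using mult_mon[OF that(1)] by auto
    ultimately show ?thesis
      using closed_cspan_subset that(2) by blast
  qed
  have adj: "adj x \<in> ?M" if "x \<in> ?M" for x
  proof -
    have "closed (adj -` ?M)"
      using M continuous_on_adj by (auto simp: closed_csubspace_def intro: closed_vimage)
    then have "closed_csubspace (adj -` ?M)"
      using M by (auto simp: closed_csubspace_def adj_add adj_scaleC)
    moreover have "range mon \<subseteq> adj -` ?M"
      by (auto simp: adj_mon scale mon)
    ultimately show ?thesis
      using closed_cspan_subset that by blast
  qed
  have "star_subalgebra ?M"
    using M mult adj scale mon[of "(0, 0)"]
    by (simp add: star_subalgebra_def closed_csubspace_def mon_0)
  moreover have "closed ?M"
    using M by (simp add: closed_csubspace_def)
  moreover have "{U, V} \<subseteq> ?M"
    using mon[of "(1, 0)"] mon[of "(0, 1)"] by (simp add: mon_U mon_V)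
  ultimately have "cstar_generated {U, V} \<subseteq> ?M"
    by (auto simp: cstar_generated_def)
  then show ?thesis
    using torus by (auto simp: nc_torus_def)
qed

lemma trace_mon: "\<tau> (mon i) = (if i = (0, 0) then 1 else 0)"
  using trace rapidly_decreasing_single[of i] nct_series_single[of U V i]
  by (force simp: nct_trace_def)

text \<open>Both sides are bilinear and continuous, and for two monomials they vanish unless the exponents
  are opposite, in which case the two phases agree.\<close>

lemma trace_commute: "\<tau> (a * b) = \<tau> (b * a)"
proof -
  have cont: "continuous_on UNIV (\<lambda>x. \<tau> (x * b))" "continuous_on UNIV (\<lambda>x. \<tau> (b * x))" for b
    by (intro bounded_linear.continuous_on[OF bounded_functional] continuous_intros)+
  have lin: "clinear (\<lambda>x. \<tau> (x * b))" "clinear (\<lambda>x. \<tau> (b * x))" for b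
    using clinear_functional
    by (simp_all add: clinear_def distrib_left distrib_right mult_scaleC_left mult_scaleC_right)
  have commute_mon: "\<tau> (mon i * mon j) = \<tau> (mon j * mon i)" for i j
    by (cases i, cases j)
      (auto simp: mon_mult clinear_scaleC[OF clinear_functional] trace_mon add_eq_0_iff mult.commute
        scaleC_complex_def)
  have commute_a: "\<tau> (a * mon j) = \<tau> (mon j * a)" for a j
    by (rule eq_on_total[OF monomials_total lin cont]) (auto simp: commute_mon)
  show ?thesis
    by (rule eq_on_total[OF monomials_total lin(2) lin(1) cont(2) cont(1)]) (auto simp: commute_a)
qed

lemma orthonormal_basis: "orthonormal basis"
proof -
  have "cinner (basis (p, q)) (basis (k, l)) = (if (p, q) = (k, l) then 1 else 0)" for p q k l
    using rot_nonzero
    by (auto simp: basis_def cinner_Lambda adj_mon mon_mult mult_scaleC_left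
        clinear_scaleC[OF clinear_functional] trace_mon power_int_minus mult.commute
        scaleC_complex_def)
  then show ?thesis
    by (simp add: orthonormal_def)
qed

lemma basis_total: "closed_cspan (range basis) = UNIV"
proof -
  let ?M = "closed_cspan (range basis)"
  have M: "closed_csubspace ?M"
    by (rule closed_csubspace_closed_cspan)
  have "closed_csubspace (\<Lambda> -` ?M)"
    by (intro closed_csubspace_vimage clinear_Lambda continuous_on_Lambda M)
  moreover have "range mon \<subseteq> \<Lambda> -` ?M"
    using closed_cspan_superset[of "range basis"] by (auto simp: basis_def)
  ultimately have "range \<Lambda> \<subseteq> ?M"
    using closed_cspan_subset monomials_total by blast
  then have "closure (range \<Lambda>) \<subseteq> ?M"
    using M by (simp add: closure_minimal closed_csubspace_def)
  then show ?thesis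
    by (simp add: dense_Lambda top.extremum_unique)
qed

lemma V_mult_smooth:
  assumes "a \<in> nct_smooth U V"
  shows "V * a \<in> nct_smooth U V"
proof -
  obtain f where f: "a = nct_series U V f" "rapidly_decreasing f"
    using assms by (auto simp: nct_smooth_def)
  define g where "g = (\<lambda>(p, q). rot powi (- p) * f (p, q - 1))"
  have V_mon: "V * mon (p, q) = (rot powi (- p)) *\<^sub>C mon (p, q + 1)" for p q
    using mon_mult[of 0 1 p q] by (simp add: mon_V add.commute)
  have "(\<Sum>\<^sub>\<infinity>i\<in>UNIV. V * (f i *\<^sub>C mon i)) = V * (\<Sum>\<^sub>\<infinity>i\<in>UNIV. f i *\<^sub>C mon i)"
    \<comment> \<open>Multiplication by \<open>V\<close> is invertible, so both sums converge or neither does.\<close>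
    by (intro infsum_bounded_linear_strong[of "\<lambda>x. V * x"] bounded_linear_mult_right
        summable_on_bounded_linear_iff[where h' = "\<lambda>x. adj V * x"])
      (simp add: unitary_elem_cancel[OF unitary_V])
  moreover have "(\<Sum>\<^sub>\<infinity>i\<in>UNIV. g i *\<^sub>C mon i) = (\<Sum>\<^sub>\<infinity>i\<in>UNIV. V * (f i *\<^sub>C mon i))"
    by (rule infsum_reindex_bij_witness[where i = "\<lambda>(p, q). (p, q + 1)" and j = "\<lambda>(p, q). (p, q - 1)"])
      (auto simp: g_def mult_scaleC_right V_mon scaleC_scaleC mult.commute)
  ultimately have "V * a = nct_series U V g"
    by (simp add: f nct_series_eq)
  moreover have "rapidly_decreasing g"
    unfolding g_def by (rule rapidly_decreasing_shift[OF f(2)]) (simp add: norm_power_int norm_rot)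
  ultimately show ?thesis
    by (auto simp: nct_smooth_def)
qed

lemma d1_eq: "nct_d1 U V \<Lambda> = diagonal_op basis (\<lambda>(p, q). of_int p)"
  using selfadjoint_eq_diagonal_op[OF orthonormal_basis basis_total, of "\<lambda>(p, q). of_int p"]
  by (simp add: nct_d1_def basis_def monomial_def)

lemma d2_eq: "nct_d2 U V \<Lambda> = diagonal_op basis (\<lambda>(p, q). of_int q)"
  using selfadjoint_eq_diagonal_op[OF orthonormal_basis basis_total, of "\<lambda>(p, q). of_int q"]
  by (simp add: nct_d2_def basis_def monomial_def)

text \<open>The adjoint of \<open>V\<close> lowers the second index of a basis vector, up to a phase.  Hence \<open>d\<^sub>1\<close>
  commutes with \<open>V\<close>, while \<open>[d\<^sub>2, V] = V\<close>.\<close>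

lemma cinner_basis_V:
  "\<exists>c. \<forall>x. cinner (basis (p, q)) (left_mult \<Lambda> V x) = c * cinner (basis (p, q - 1)) x"
proof -
  have "adj V * mon (p, q) = (rot powi p) *\<^sub>C mon (p, q - 1)"
    using adj_mon[of 0 1] mon_mult[of 0 "- 1" p q] by (simp add: mon_V add.commute)
  then show ?thesis
    by (intro exI[of _ "cnj (rot powi p)"])
      (simp add: basis_def cinner_left_mult Lambda_scaleC cinner_scaleC_left)
qed

lemma d1_left_mult_V:
  assumes "(x, u) \<in> nct_d1 U V \<Lambda>"
  shows "(left_mult \<Lambda> V x, left_mult \<Lambda> V u) \<in> nct_d1 U V \<Lambda>"
  unfolding d1_eq diagonal_op_def
proof clarsimp
  fix p q
  obtain c where "\<And>x. cinner (basis (p, q)) (left_mult \<Lambda> V x) = c * cinner (basis (p, q - 1)) x"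
    using cinner_basis_V[of p q] by blast
  then show "cinner (basis (p, q)) (left_mult \<Lambda> V u)
      = of_int p * cinner (basis (p, q)) (left_mult \<Lambda> V x)"
    using assms by (simp add: d1_eq diagonal_op_def)
qed

lemma d2_left_mult_V:
  assumes "(x, u) \<in> nct_d2 U V \<Lambda>"
  shows "(left_mult \<Lambda> V x, left_mult \<Lambda> V u + left_mult \<Lambda> V x) \<in> nct_d2 U V \<Lambda>"
  unfolding d2_eq diagonal_op_def
proof clarsimp
  fix p q
  obtain c where "\<And>x. cinner (basis (p, q)) (left_mult \<Lambda> V x) = c * cinner (basis (p, q - 1)) x"
    using cinner_basis_V[of p q] by blast
  then show "cinner (basis (p, q)) (left_mult \<Lambda> V u + left_mult \<Lambda> V x)
      = of_int q * cinner (basis (p, q)) (left_mult \<Lambda> V x)"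
    using assms by (simp add: d2_eq diagonal_op_def cinner_add_right algebra_simps)
qed

end


section \<open>The Dirac operators and their commutators with a generator\<close>

definition pair_op :: "('h \<Rightarrow> 'h) \<Rightarrow> 'h \<times> 'h \<Rightarrow> 'h \<times> 'h" where
  "pair_op T = (\<lambda>(x, y). (T x, T y))"

context nc_torus_gns
begin

abbreviation "L \<equiv> left_mult \<Lambda>"

text \<open>The operator whose closure is \<open>D\<close>; the choice \<open>r = 0\<close> gives \<open>D\<^sub>0\<close>, so that both Dirac operators
  are covered at once.\<close>

definition dirac_core :: "'a \<Rightarrow> ('h \<times> 'h, 'h \<times> 'h) graph" where
  "dirac_core r = op_restrict
     (op_add (nct_dirac0_matrix U V \<Lambda>)
        (op_offdiag (nct_commutator U V \<Lambda> r) (nct_commutator U V \<Lambda> (adj r))))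
     (nct_core U V \<Lambda>)"

text \<open>The commutator of \<open>D\<close> with \<open>V\<close>, which is bounded.  The terms \<open>\<plusminus>\<i> V\<close> come from \<open>[d\<^sub>2, V] = V\<close>;
  right multiplication by \<open>r\<close> commutes with \<open>V\<close>, so \<open>d\<^sub>r\<close> contributes only the element \<open>[r, V]\<close>.\<close>

definition dirac_commutator :: "'a \<Rightarrow> 'h \<times> 'h \<Rightarrow> 'h \<times> 'h" where
  "dirac_commutator r = (\<lambda>(x, y).
     (\<i> *\<^sub>C L V y + L (r * V - V * r) y, (- \<i>) *\<^sub>C L V x + L (adj r * V - V * adj r) x))"

lemma nct_dirac_eq: "nct_dirac U V \<Lambda> r = closure (dirac_core r)"
  by (simp add: nct_dirac_def dirac_core_def)

lemma nct_dirac0_eq: "nct_dirac0 U V \<Lambda> = closure (dirac_core 0)"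
proof -
  have "op_offdiag (nct_commutator U V \<Lambda> 0) (nct_commutator U V \<Lambda> (adj 0))
      = {(\<xi>, 0) | \<xi>. \<xi> \<in> nct_core U V \<Lambda>}"
    by (auto simp: nct_commutator_def Lambda_0 op_offdiag_def nct_core_def zero_prod_def)
  then have "dirac_core 0 = op_restrict (nct_dirac0_matrix U V \<Lambda>) (nct_core U V \<Lambda>)"
    by (auto simp: dirac_core_def op_restrict_def op_add_def zero_prod_def)
  then show ?thesis
    by (simp add: nct_dirac0_def)
qed

lemma dirac_coreI:
  assumes "a \<in> nct_smooth U V" "b \<in> nct_smooth U V"
    and "(\<Lambda> b, u1) \<in> nct_d1 U V \<Lambda>" "(\<Lambda> b, u2) \<in> nct_d2 U V \<Lambda>"
    and "(\<Lambda> a, v1) \<in> nct_d1 U V \<Lambda>" "(\<Lambda> a, v2) \<in> nct_d2 U V \<Lambda>"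
  shows "((\<Lambda> a, \<Lambda> b), (u1 + \<i> *\<^sub>C u2 + \<Lambda> (r * b - b * r),
    v1 + (- \<i>) *\<^sub>C v2 + \<Lambda> (adj r * a - a * adj r))) \<in> dirac_core r"
proof -
  have "((\<Lambda> a, \<Lambda> b), (u1 + \<i> *\<^sub>C u2, v1 + (- \<i>) *\<^sub>C v2)) \<in> nct_dirac0_matrix U V \<Lambda>"
    using assms by (auto simp: nct_dirac0_matrix_def op_offdiag_def op_add_def op_scaleC_def)
  moreover have "((\<Lambda> a, \<Lambda> b), (\<Lambda> (r * b - b * r), \<Lambda> (adj r * a - a * adj r)))
      \<in> op_offdiag (nct_commutator U V \<Lambda> r) (nct_commutator U V \<Lambda> (adj r))"
    using assms by (auto simp: op_offdiag_def nct_commutator_def)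
  moreover have "(\<Lambda> a, \<Lambda> b) \<in> nct_core U V \<Lambda>"
    using assms by (simp add: nct_core_def)
  ultimately show ?thesis
    by (force simp: dirac_core_def op_restrict_def op_add_def)
qed

lemma dirac_coreE:
  assumes "(\<xi>, \<eta>) \<in> dirac_core r"
  obtains a b u1 u2 v1 v2 where "a \<in> nct_smooth U V" "b \<in> nct_smooth U V" "\<xi> = (\<Lambda> a, \<Lambda> b)"
    "(\<Lambda> b, u1) \<in> nct_d1 U V \<Lambda>" "(\<Lambda> b, u2) \<in> nct_d2 U V \<Lambda>"
    "(\<Lambda> a, v1) \<in> nct_d1 U V \<Lambda>" "(\<Lambda> a, v2) \<in> nct_d2 U V \<Lambda>"
    "\<eta> = (u1 + \<i> *\<^sub>C u2 + \<Lambda> (r * b - b * r), v1 + (- \<i>) *\<^sub>C v2 + \<Lambda> (adj r * a - a * adj r))"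
proof -
  obtain \<eta>1 \<eta>2 where \<eta>: "\<eta> = \<eta>1 + \<eta>2" "(\<xi>, \<eta>1) \<in> nct_dirac0_matrix U V \<Lambda>"
    "(\<xi>, \<eta>2) \<in> op_offdiag (nct_commutator U V \<Lambda> r) (nct_commutator U V \<Lambda> (adj r))"
    using assms by (auto simp: dirac_core_def op_restrict_def op_add_def)
  from \<eta>(3) obtain a b where ab: "a \<in> nct_smooth U V" "b \<in> nct_smooth U V" "\<xi> = (\<Lambda> a, \<Lambda> b)"
    "\<eta>2 = (\<Lambda> (r * b - b * r), \<Lambda> (adj r * a - a * adj r))"
    by (auto simp: op_offdiag_def nct_commutator_def)
  from \<eta>(2) obtain u1 u2 v1 v2 where
    "(\<Lambda> b, u1) \<in> nct_d1 U V \<Lambda>" "(\<Lambda> b, u2) \<in> nct_d2 U V \<Lambda>"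
    "(\<Lambda> a, v1) \<in> nct_d1 U V \<Lambda>" "(\<Lambda> a, v2) \<in> nct_d2 U V \<Lambda>"
    "\<eta>1 = (u1 + \<i> *\<^sub>C u2, v1 + (- \<i>) *\<^sub>C v2)"
    by (auto simp: ab nct_dirac0_matrix_def op_offdiag_def op_add_def op_scaleC_def)
  then show ?thesis
    using that ab \<eta>(1) by simp
qed

text \<open>By traciality the adjoint of \<open>x \<mapsto> r x - x r\<close> is \<open>x \<mapsto> r* x - x r*\<close>.\<close>

lemma cinner_commutator:
  "cinner (\<Lambda> a) (\<Lambda> (r * b - b * r)) = cinner (\<Lambda> (adj r * a - a * adj r)) (\<Lambda> b)"
proof -
  have "\<tau> (adj a * (b * r)) = \<tau> (r * (adj a * b))"
    using trace_commute[of "adj a * b" r] by (simp add: mult.assoc)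
  then show ?thesis
    by (simp add: cinner_Lambda adj_diff adj_mult adj_adj left_diff_distrib right_diff_distrib
        clinear_diff[OF clinear_functional] mult.assoc)
qed

lemma dirac_core_symmetric:
  assumes "(\<xi>, \<eta>) \<in> dirac_core r" "(\<xi>', \<eta>') \<in> dirac_core r"
  shows "cinner \<xi> \<eta>' = cinner \<eta> \<xi>'"
proof -
  from assms(1) obtain a b u1 u2 v1 v2 where *: "\<xi> = (\<Lambda> a, \<Lambda> b)"
    "(\<Lambda> b, u1) \<in> nct_d1 U V \<Lambda>" "(\<Lambda> b, u2) \<in> nct_d2 U V \<Lambda>"
    "(\<Lambda> a, v1) \<in> nct_d1 U V \<Lambda>" "(\<Lambda> a, v2) \<in> nct_d2 U V \<Lambda>"
    "\<eta> = (u1 + \<i> *\<^sub>C u2 + \<Lambda> (r * b - b * r), v1 + (- \<i>) *\<^sub>C v2 + \<Lambda> (adj r * a - a * adj r))"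
    by (rule dirac_coreE)
  from assms(2) obtain a' b' u1' u2' v1' v2' where **: "\<xi>' = (\<Lambda> a', \<Lambda> b')"
    "(\<Lambda> b', u1') \<in> nct_d1 U V \<Lambda>" "(\<Lambda> b', u2') \<in> nct_d2 U V \<Lambda>"
    "(\<Lambda> a', v1') \<in> nct_d1 U V \<Lambda>" "(\<Lambda> a', v2') \<in> nct_d2 U V \<Lambda>"
    "\<eta>' = (u1' + \<i> *\<^sub>C u2' + \<Lambda> (r * b' - b' * r), v1' + (- \<i>) *\<^sub>C v2' + \<Lambda> (adj r * a' - a' * adj r))"
    by (rule dirac_coreE)
  note symmetric = diagonal_op_symmetric[OF orthonormal_basis basis_total]
  have "cinner (\<Lambda> a) u1' = cinner v1 (\<Lambda> b')" "cinner (\<Lambda> a) u2' = cinner v2 (\<Lambda> b')"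
    "cinner (\<Lambda> b) v1' = cinner u1 (\<Lambda> a')" "cinner (\<Lambda> b) v2' = cinner u2 (\<Lambda> a')"
    using * ** by (auto simp: d1_eq d2_eq intro: symmetric)
  then show ?thesis
    using cinner_commutator[of a r b'] cinner_commutator[of b "adj r" a']
    by (simp add: * ** cinner_prod_def cinner_add_left cinner_add_right cinner_scaleC_left
        cinner_scaleC_right adj_adj)
qed

definition pair_basis :: "('h \<times> 'h) set" where
  "pair_basis = {(basis i, 0) | i. True} \<union> {(0, basis i) | i. True}"

lemma pair_basis_in_domain: "\<xi> \<in> pair_basis \<Longrightarrow> \<xi> \<in> Domain (dirac_core r)"
proof -
  have b: "(\<Lambda> (mon i), of_real (w i) *\<^sub>C \<Lambda> (mon i)) \<in> diagonal_op basis w" for i w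
    using diagonal_op_basis[OF orthonormal_basis] by (simp add: basis_def)
  have z: "(\<Lambda> 0, 0) \<in> diagonal_op basis w" for w
    by (simp add: diagonal_op_def Lambda_0)
  have "(\<Lambda> (mon i), \<Lambda> 0) \<in> Domain (dirac_core r)" "(\<Lambda> 0, \<Lambda> (mon i)) \<in> Domain (dirac_core r)" for i
    using dirac_coreI[OF monomial_smooth zero_smooth, unfolded d1_eq d2_eq, OF z z b b]
      dirac_coreI[OF zero_smooth monomial_smooth, unfolded d1_eq d2_eq, OF b b z z]
    by blast+
  then show "\<xi> \<in> pair_basis \<Longrightarrow> \<xi> \<in> Domain (dirac_core r)"
    by (auto simp: pair_basis_def basis_def Lambda_0)
qed

lemma pair_basis_total: "closed_cspan pair_basis = UNIV"
proof -
  let ?M = "closed_cspan pair_basis"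
  have M: "closed_csubspace ?M"
    by (rule closed_csubspace_closed_cspan)
  have lin: "clinear (\<lambda>x::'h. (x, 0::'h))" "clinear (\<lambda>x::'h. (0::'h, x))"
    by (simp_all add: clinear_def scaleC_prod_def)
  have sub: "(basis i, 0) \<in> ?M" "(0, basis i) \<in> ?M" for i
    using closed_cspan_superset[of pair_basis] unfolding pair_basis_def by blast+
  have "closed_cspan (range basis) \<subseteq> (\<lambda>x. (x, 0)) -` ?M"
    by (intro closed_cspan_subset closed_csubspace_vimage lin M continuous_intros)
      (use sub in blast)
  moreover have "closed_cspan (range basis) \<subseteq> (\<lambda>x. (0, x)) -` ?M"
    by (intro closed_cspan_subset closed_csubspace_vimage lin M continuous_intros)
      (use sub in blast)
  ultimately have "(x, 0) \<in> ?M" "(0, y) \<in> ?M" for x y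
    by (auto simp: basis_total)
  then have "(x, 0) + (0, y) \<in> ?M" for x y
    using M unfolding closed_csubspace_def by blast
  then show ?thesis
    by auto
qed

text \<open>A densely defined symmetric operator is closable: the difference of two values at the same
  point is orthogonal to the domain.\<close>

lemma dirac_single_valued:
  assumes "(\<xi>, \<eta>) \<in> nct_dirac U V \<Lambda> r" "(\<xi>, \<eta>') \<in> nct_dirac U V \<Lambda> r"
  shows "\<eta> = \<eta>'"
proof -
  have sym: "cinner \<zeta> \<eta> = cinner \<omega> \<xi>"
    if "(\<zeta>, \<omega>) \<in> dirac_core r" "(\<xi>, \<eta>) \<in> nct_dirac U V \<Lambda> r" for \<zeta> \<omega> \<xi> \<eta>
  proof -
    have "closure (dirac_core r) \<subseteq> {p. cinner \<zeta> (snd p) = cinner \<omega> (fst p)}"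
      using dirac_core_symmetric[OF that(1)]
      by (intro closure_minimal closed_Collect_eq continuous_intros) auto
    then show ?thesis
      using that(2) by (auto simp: nct_dirac_eq)
  qed
  have "cinner \<zeta> (\<eta> - \<eta>') = 0" if \<zeta>: "\<zeta> \<in> pair_basis" for \<zeta>
  proof -
    obtain \<omega> where "(\<zeta>, \<omega>) \<in> dirac_core r"
      using pair_basis_in_domain[OF \<zeta>, of r] by blast
    then show ?thesis
      using sym[OF _ assms(1)] sym[OF _ assms(2)] by (simp add: cinner_diff_right)
  qed
  then have "\<eta> - \<eta>' = 0"
    by (rule orthogonal_to_total[OF pair_basis_total])
  then show ?thesis
    by simp
qed

lemma continuous_on_pair_op:
  "continuous_on S f \<Longrightarrow> continuous_on S (\<lambda>x. pair_op (L V) (f x))"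
  unfolding pair_op_def case_prod_unfold by (intro continuous_intros)

lemma continuous_on_dirac_commutator:
  "continuous_on S f \<Longrightarrow> continuous_on S (\<lambda>x. dirac_commutator r (f x))"
  unfolding dirac_commutator_def case_prod_unfold
  by (intro continuous_on_Pair continuous_on_add continuous_on_scaleC continuous_on_left_mult
      continuous_on_fst continuous_on_snd)

lemma clinear_dirac_commutator: "clinear (dirac_commutator r)"
  unfolding clinear_def
proof (intro conjI allI)
  fix \<xi> \<eta> :: "'h \<times> 'h" and c
  note linear = clinear_add[OF clinear_left_mult] clinear_scaleC[OF clinear_left_mult]
  show "dirac_commutator r (\<xi> + \<eta>) = dirac_commutator r \<xi> + dirac_commutator r \<eta>"
    by (cases \<xi>; cases \<eta>) (simp add: dirac_commutator_def linear scaleC_add_right add_ac)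
  show "dirac_commutator r (c *\<^sub>C \<xi>) = c *\<^sub>C dirac_commutator r \<xi>"
    by (cases \<xi>)
      (simp add: dirac_commutator_def scaleC_prod_def linear scaleC_add_right scaleC_scaleC
        mult.commute[of c])
qed

lemma dirac_core_V:
  assumes "(\<xi>, \<eta>) \<in> dirac_core r"
  shows "(pair_op (L V) \<xi>, pair_op (L V) \<eta> + dirac_commutator r \<xi>) \<in> dirac_core r"
proof -
  from assms obtain a b u1 u2 v1 v2 where *: "a \<in> nct_smooth U V" "b \<in> nct_smooth U V"
    "\<xi> = (\<Lambda> a, \<Lambda> b)" "(\<Lambda> b, u1) \<in> nct_d1 U V \<Lambda>" "(\<Lambda> b, u2) \<in> nct_d2 U V \<Lambda>"
    "(\<Lambda> a, v1) \<in> nct_d1 U V \<Lambda>" "(\<Lambda> a, v2) \<in> nct_d2 U V \<Lambda>"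
    "\<eta> = (u1 + \<i> *\<^sub>C u2 + \<Lambda> (r * b - b * r), v1 + (- \<i>) *\<^sub>C v2 + \<Lambda> (adj r * a - a * adj r))"
    by (rule dirac_coreE)
  have commutator: "\<Lambda> (s * (V * x) - V * x * s) = L V (\<Lambda> (s * x - x * s)) + L (s * V - V * s) (\<Lambda> x)"
    for s x
    by (simp add: left_mult_Lambda algebra_simps flip: Lambda_add)
  note d1 = d1_left_mult_V[of "\<Lambda> _", unfolded left_mult_Lambda]
  note d2 = d2_left_mult_V[of "\<Lambda> _", unfolded left_mult_Lambda]
  have "((\<Lambda> (V * a), \<Lambda> (V * b)),
      (L V u1 + \<i> *\<^sub>C (L V u2 + \<Lambda> (V * b)) + \<Lambda> (r * (V * b) - V * b * r),
       L V v1 + (- \<i>) *\<^sub>C (L V v2 + \<Lambda> (V * a)) + \<Lambda> (adj r * (V * a) - V * a * adj r)))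
      \<in> dirac_core r"
    using * by (intro dirac_coreI V_mult_smooth d1 d2)
  also have "(L V u1 + \<i> *\<^sub>C (L V u2 + \<Lambda> (V * b)) + \<Lambda> (r * (V * b) - V * b * r),
       L V v1 + (- \<i>) *\<^sub>C (L V v2 + \<Lambda> (V * a)) + \<Lambda> (adj r * (V * a) - V * a * adj r))
      = pair_op (L V) \<eta> + dirac_commutator r \<xi>"
    unfolding commutator
    by (simp add: * pair_op_def dirac_commutator_def clinear_add[OF clinear_left_mult]
        clinear_scaleC[OF clinear_left_mult] scaleC_add_right left_mult_Lambda add_ac)
  also have "(\<Lambda> (V * a), \<Lambda> (V * b)) = pair_op (L V) \<xi>"
    by (simp add: * pair_op_def left_mult_Lambda)
  finally show ?thesis .
qed

text \<open>The commutator relation of the core passes to the closure by continuity.  It has to: a unitary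
  equivalence maps the closure of one core to the closure of the other, but need not respect the
  cores themselves.\<close>

lemma dirac_V:
  assumes "(\<xi>, \<eta>) \<in> nct_dirac U V \<Lambda> r"
  shows "(pair_op (L V) \<xi>, pair_op (L V) \<eta> + dirac_commutator r \<xi>) \<in> nct_dirac U V \<Lambda> r"
proof -
  have "(\<lambda>p. (pair_op (L V) (fst p), pair_op (L V) (snd p) + dirac_commutator r (fst p)))
      ` closure (dirac_core r) \<subseteq> closure (dirac_core r)"
    using dirac_core_V closure_subset[of "dirac_core r"]
    by (intro image_closure_subset continuous_intros continuous_on_pair_op
        continuous_on_dirac_commutator) auto
  then show ?thesis
    using assms by (force simp: nct_dirac_eq)
qed

lemma left_mult_0: "L 0 x = 0"
proof (rule closed_property_on_Lambda[where x = x])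
  show "closed {x. L 0 x = 0}"
    by (intro closed_Collect_eq continuous_intros)
qed (simp add: left_mult_Lambda Lambda_0)

lemma norm_dirac_commutator_0: "norm (dirac_commutator 0 \<xi>) = norm \<xi>"
proof -
  have "norm (c *\<^sub>C L V x) = norm x" if "cmod c = 1" for c x
    by (simp add: norm_scaleC_hilbert norm_left_mult_unitary[OF unitary_V] that)
  then show ?thesis
    by (cases \<xi>) (simp add: dirac_commutator_def left_mult_0 norm_Pair add.commute)
qed

text \<open>The vector is \<open>\<i> V + (1 - \<lambda> powi (- m)) U\<^sup>m V\<close> in the first component, where \<open>\<lambda>\<close> is \<open>rot\<close>; its two summands are orthogonal.\<close>

lemma norm_dirac_commutator_power:
  assumes "m \<noteq> 0"
  shows "(norm (dirac_commutator (upow U m) (0, basis (0, 0))))\<^sup>2 = 1 + (cmod (1 - rot powi (- m)))\<^sup>2"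
proof -
  let ?c = "1 - rot powi (- m)"
  have "upow U m * V = mon (m, 1)"
    by (simp add: monomial_def)
  moreover have "V * upow U m = (rot powi (- m)) *\<^sub>C mon (m, 1)"
    using upow_V_upow_U[of 1 m] by simp
  ultimately have "upow U m * V - V * upow U m = ?c *\<^sub>C mon (m, 1)"
    by (simp add: scaleC_diff_left)
  moreover have "L a 0 = 0" for a
    by (rule clinear_0[OF clinear_left_mult])
  ultimately have "dirac_commutator (upow U m) (0, basis (0, 0))
      = (\<i> *\<^sub>C basis (0, 1) + ?c *\<^sub>C basis (m, 1), 0)" (is "_ = (?x, 0)")
    by (simp add: dirac_commutator_def basis_def left_mult_Lambda mon_0 mon_V mult_scaleC_left
        Lambda_scaleC)
  then have "(norm (dirac_commutator (upow U m) (0, basis (0, 0))))\<^sup>2 = (norm ?x)\<^sup>2"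
    by (simp add: norm_Pair)
  moreover have "complex_of_real ((norm ?x)\<^sup>2) = of_real (1 + (cmod ?c)\<^sup>2)"
    unfolding cinner_self[symmetric]
    using orthonormal_basis assms
    by (simp add: cinner_add_left cinner_add_right cinner_scaleC_left cinner_scaleC_right
        orthonormal_def complex_norm_square mult.commute del: of_real_power)
  ultimately show ?thesis
    unfolding of_real_eq_iff by simp
qed

lemma rot_power_neq_1:
  assumes "\<theta> \<notin> \<rat>" and "m \<noteq> 0"
  shows "rot powi m \<noteq> 1"
proof
  assume "rot powi m = 1"
  then have "exp (of_int m * (2 * of_real pi * \<i> * of_real \<theta>)) = (1::complex)"
    by (simp add: rot_def exp_power_int)
  then obtain n :: int where "of_int m * (2 * pi * \<theta>) = of_int (2 * n) * pi"
    by (auto simp: exp_eq_1)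
  then have "\<theta> = of_int n / of_int m"
    using \<open>m \<noteq> 0\<close> by (simp add: field_simps)
  then have "\<theta> \<in> \<rat>"
    by simp
  with assms(1) show False
    by simp
qed

lemma V_smooth: "V \<in> nct_smooth U V"
  using monomial_smooth[of U V "(0, 1)"] by (simp add: mon_V)

section \<open>Inequivalence of the spectral triples\<close>

text \<open>If \<open>\<eta>\<close> is the value of the first operator at \<open>\<xi>\<close>, then applying \<open>W\<close> and the commutator
  relation in either order gives two values of the second operator at \<open>V (W \<xi>)\<close>, and these agree
  because that operator is single-valued.\<close>

lemma unitary_intertwines_dirac_commutator:
  assumes W: "unitary_op W"
    and dirac: "nct_dirac U V \<Lambda> s = {(W x, W y) | x y. (x, y) \<in> nct_dirac U V \<Lambda> r}"
    and WV: "\<And>\<xi>. W (pair_op (L V) \<xi>) = pair_op (L V) (W \<xi>)"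
  shows "W (dirac_commutator r \<xi>) = dirac_commutator s (W \<xi>)"
proof -
  have lin: "clinear W"
    using W by (simp add: unitary_op_def)
  have "norm (W x) \<le> norm x * 1" for x
    by (simp add: norm_unitary_op[OF W])
  then have "bounded_linear W"
    using lin clinear_imp_bounded_linear by blast
  then have cont: "continuous_on UNIV (\<lambda>x. W (f x))" if "continuous_on UNIV f"
    for f :: "'h \<times> 'h \<Rightarrow> 'h \<times> 'h"
    using that by (rule bounded_linear.continuous_on)
  have on_basis: "W (dirac_commutator r \<xi>) = dirac_commutator s (W \<xi>)" if \<xi>: "\<xi> \<in> pair_basis" for \<xi>
  proof -
    obtain \<eta> where \<eta>: "(\<xi>, \<eta>) \<in> nct_dirac U V \<Lambda> r"
      using pair_basis_in_domain[OF \<xi>, of r] closure_subset[of "dirac_core r"]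
      by (auto simp: nct_dirac_eq)
    have W_dirac: "(W x, W y) \<in> nct_dirac U V \<Lambda> s" if "(x, y) \<in> nct_dirac U V \<Lambda> r" for x y
      unfolding dirac using that by blast
    have "(pair_op (L V) (W \<xi>), pair_op (L V) (W \<eta>) + W (dirac_commutator r \<xi>))
        \<in> nct_dirac U V \<Lambda> s"
      using W_dirac[OF dirac_V[OF \<eta>]] by (simp add: clinear_add[OF lin] WV)
    moreover have "(pair_op (L V) (W \<xi>), pair_op (L V) (W \<eta>) + dirac_commutator s (W \<xi>))
        \<in> nct_dirac U V \<Lambda> s"
      by (rule dirac_V[OF W_dirac[OF \<eta>]])
    ultimately show ?thesis
      using dirac_single_valued by fastforce
  qed
  have lins: "clinear (\<lambda>\<xi>. W (dirac_commutator r \<xi>))" "clinear (\<lambda>\<xi>. dirac_commutator s (W \<xi>))"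
    using clinear_compose[OF lin clinear_dirac_commutator[of r]]
      clinear_compose[OF clinear_dirac_commutator[of s] lin] by simp_all
  have conts: "continuous_on UNIV (\<lambda>\<xi>. W (dirac_commutator r \<xi>))"
    "continuous_on UNIV (\<lambda>\<xi>. dirac_commutator s (W \<xi>))"
    using cont[OF continuous_on_dirac_commutator[OF continuous_on_id, where r = r]]
      continuous_on_dirac_commutator[OF cont[OF continuous_on_id], where r = s] by simp_all
  show ?thesis
    by (rule eq_on_total[OF pair_basis_total lins conts on_basis])
qed

lemma not_unitarily_equivalent:
  assumes "rot powi (- m) \<noteq> 1"
  shows "\<not> unitarily_equivalent (nct_triple U V \<Lambda> (nct_dirac0 U V \<Lambda>))
    (nct_triple U V \<Lambda> (nct_dirac U V \<Lambda> (upow U m)))"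
proof
  assume "unitarily_equivalent (nct_triple U V \<Lambda> (nct_dirac0 U V \<Lambda>))
    (nct_triple U V \<Lambda> (nct_dirac U V \<Lambda> (upow U m)))"
  then obtain W where W: "unitary_op W"
    and dirac: "nct_dirac U V \<Lambda> (upow U m) = {(W x, W y) | x y. (x, y) \<in> nct_dirac U V \<Lambda> 0}"
    and repr: "pair_op (L V) = W \<circ> pair_op (L V) \<circ> inv W"
    using V_smooth
    by (auto simp: unitarily_equivalent_def nct_triple_def nct_dirac0_eq pair_op_def
        simp flip: nct_dirac_eq)
  note norm_W = norm_unitary_op[OF W]
  have "inj W"
  proof (rule injI)
    fix x y assume "W x = W y"
    then have "W (x - y) = 0"
      using W by (simp add: unitary_op_def clinear_diff)
    then show "x = y"
      using norm_W[of "x - y"] by simp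
  qed
  then have "W (pair_op (L V) \<xi>) = pair_op (L V) (W \<xi>)" for \<xi>
    using fun_cong[OF repr, of "W \<xi>"] by simp
  note intertwine = unitary_intertwines_dirac_commutator[OF W dirac this]
  let ?\<zeta> = "(0, basis (0, 0)) :: 'h \<times> 'h"
  obtain \<xi> where \<xi>: "?\<zeta> = W \<xi>"
    using W unfolding unitary_op_def by (metis surjD)
  have "norm (dirac_commutator (upow U m) ?\<zeta>) = norm ?\<zeta>"
    unfolding \<xi> by (simp add: norm_W norm_dirac_commutator_0 flip: intertwine)
  moreover have "cmod (cinner (basis (0, 0)) (basis (0, 0))) = 1"
    using orthonormal_basis by (simp add: orthonormal_def)
  then have "(norm ?\<zeta>)\<^sup>2 = 1"
    by (simp add: cinner_self norm_power norm_Pair)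
  ultimately show False
    using norm_dirac_commutator_power[of m] assms by (cases "m = 0") simp_all
qed

end


theorem theorem4p4:
  fixes \<theta> :: real and m :: int
    and U V :: "'a::cstar_algebra"
    and \<tau> :: "'a \<Rightarrow> complex"
    and \<Lambda> :: "'a \<Rightarrow> 'h::complex_hilbert_space"
  assumes "\<theta> \<in> {0..1}" and "\<theta> \<notin> \<rat>"
    and "m \<noteq> 0"
    and "nc_torus \<theta> U V"
    and "nct_trace U V \<tau>"
    and "L2_space \<tau> \<Lambda>"
  shows "\<not> unitarily_equivalent
             (nct_triple U V \<Lambda> (nct_dirac0 U V \<Lambda>))
             (nct_triple U V \<Lambda> (nct_dirac U V \<Lambda> (upow U m)))"
proof -
  interpret nc_torus_gns \<tau> \<Lambda> \<theta> U V
  proof (rule nc_torus_gns.intro)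
    show "gns \<tau> \<Lambda>"
      using assms unfolding nct_trace_def by (intro gns.intro) blast+
    show "nc_torus_gns_axioms \<tau> \<theta> U V"
      using assms by (intro nc_torus_gns_axioms.intro)
  qed
  show ?thesis
    using rot_power_neq_1[of "- m"] assms by (intro not_unitarily_equivalent) simp
qed

end
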